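(* Let $\mathcal S$ be a special pre-abelian category consisting of group objects and let $\mathcal S_1$ be its full subcategory of objects killed by $p$. Let $D$ be an object of $\mathcal S_1$ such that $\mathrm{Ext}_{\mathcal S_1}(D,D)=0$. If $(C^{(n)},i^{(n)})_{n\geqslant0}$ and $(C_1^{(n)},i_1^{(n)})_{n\geqslant0}$ are $p$-divisible groups in $\mathcal S$ such that $C^{(1)}\cong C_1^{(1)}\cong D$, then these $p$-divisible groups are isomorphic, i.e. there are isomorphisms $f_n:C^{(n)}\to C_1^{(n)}$ ($n\geqslant0$) with $f_{n+1}\circ i^{(n)}=i_1^{(n)}\circ f_n$ for all $n$.
   Context: $p$ is a fixed prime. A pre-abelian category is an additive category in which every morphism has a kernel and a cokernel. A morphism $u$ is strict if the canonical morphism $\mathrm{Coker}(\mathrm{Ker}\,u)\to\mathrm{Ker}(\mathrm{Coker}\,u)$ is an isomorphism; strict monomorphisms/epimorphisms are monomorphisms/epimorphisms that are strict. A sequence $0\to A_1\xrightarrow{i}A\xrightarrow{j}A_2\to0$ is short exact if $(A_1,i)=\mathrm{Ker}\,j$ and $(A_2,j)=\mathrm{Coker}\,i$. A pre-abelian category is special if (A1) for every strict monomorphism $\alpha:C\to A$ and every morphism $\beta:C\to B$, the induced morphism $B\to A\coprod_CB$ into the pushout is a strict monomorphism, and (A2) for every strict epimorphism $f:A\to C$ and every morphism $g:B\to C$, the induced morphism $A\prod_CB\to B$ from the pullback is a strict epimorphism. "Consisting of group objects" means objects carry commutative group structures respected by morphisms. An object $A$ is killed by $p$ if $p\cdot\mathrm{id}_A=0$.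 $\mathrm{Ext}_{\mathcal S_1}(A_2,A_1)$ is the set of equivalence classes of short exact sequences $0\to A_1\to A\to A_2\to0$ in $\mathcal S_1$; $\mathrm{Ext}_{\mathcal S_1}(A_2,A_1)=0$ means every such sequence splits. A $p$-divisible group in $\mathcal S$ is an inductive system $(C^{(n)},i^{(n)})_{n\geqslant0}$ of objects of $\mathcal S$ with $C^{(0)}=0$ and strict monomorphisms $i^{(n)}:C^{(n)}\to C^{(n+1)}$, such that, writing $i_{mn}=i^{(n-1)}\circ\dots\circ i^{(m)}:C^{(m)}\to C^{(n)}$, for all $0\leqslant m\leqslant n$: (a) there are morphisms $j_{n,n-m}:C^{(n)}\to C^{(n-m)}$ with $(C^{(n-m)},j_{n,n-m})=\mathrm{Coker}\,i_{mn}$, so $0\to C^{(m)}\xrightarrow{i_{mn}}C^{(n)}\xrightarrow{j_{n,n-m}}C^{(n-m)}\to0$ is short exact; (b) $i_{n-m,n}\circ j_{n,n-m}=p^m\,\mathrm{id}_{C^{(n)}}$. *)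

theory Defs
  imports "HOL-Algebra.Group" "HOL-Computational_Algebra.Primes"
begin

text \<open>A category is given by its sets of objects and morphisms; every morphism has one domain and
  one codomain.  \<open>Add\<close> and \<open>Zero\<close> are the addition and the zero elements of the groups of
  morphisms between two fixed objects.\<close>

record ('o, 'm) cat =
  Obj :: "'o set"
  Arr :: "'m set"
  Dom :: "'m \<Rightarrow> 'o"
  Cod :: "'m \<Rightarrow> 'o"
  Idm :: "'o \<Rightarrow> 'm"
  Comp :: "'m \<Rightarrow> 'm \<Rightarrow> 'm"  (infixr "\<cdot>\<index>" 70)
  Add :: "'m \<Rightarrow> 'm \<Rightarrow> 'm"
  Zero :: "'o \<Rightarrow> 'o \<Rightarrow> 'm"

definition Hom :: "('o, 'm) cat \<Rightarrow> 'o \<Rightarrow> 'o \<Rightarrow> 'm set" where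
  "Hom C A B = {f \<in> Arr C. Dom C f = A \<and> Cod C f = B}"

text \<open>The group is written multiplicatively by the library, so the multiple \<open>n \<cdot> f\<close> is
  \<open>f [^] n\<close> computed in it.\<close>

definition Hom_group :: "('o, 'm) cat \<Rightarrow> 'o \<Rightarrow> 'o \<Rightarrow> 'm monoid" where
  "Hom_group C A B = \<lparr>carrier = Hom C A B, monoid.mult = Add C, one = Zero C A B\<rparr>"

definition nat_mult :: "('o, 'm) cat \<Rightarrow> nat \<Rightarrow> 'm \<Rightarrow> 'm" where
  "nat_mult C n f = f [^]\<^bsub>Hom_group C (Dom C f) (Cod C f)\<^esub> n"

definition is_zero_object :: "('o, 'm) cat \<Rightarrow> 'o \<Rightarrow> bool" where
  "is_zero_object C Z \<longleftrightarrow> Z \<in> Obj C \<and>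
     (\<forall>A\<in>Obj C. (\<exists>!f. f \<in> Hom C A Z) \<and> (\<exists>!f. f \<in> Hom C Z A))"

definition is_isomorphism :: "('o, 'm) cat \<Rightarrow> 'm \<Rightarrow> bool" where
  "is_isomorphism C f \<longleftrightarrow> f \<in> Arr C \<and>
     (\<exists>g\<in>Hom C (Cod C f) (Dom C f).
        g \<cdot>\<^bsub>C\<^esub> f = Idm C (Dom C f) \<and> f \<cdot>\<^bsub>C\<^esub> g = Idm C (Cod C f))"

definition isomorphic :: "('o, 'm) cat \<Rightarrow> 'o \<Rightarrow> 'o \<Rightarrow> bool" where
  "isomorphic C A B \<longleftrightarrow> (\<exists>f\<in>Hom C A B. is_isomorphism C f)"

definition is_mono :: "('o, 'm) cat \<Rightarrow> 'm \<Rightarrow> bool" where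
  "is_mono C f \<longleftrightarrow> f \<in> Arr C \<and>
     (\<forall>T. \<forall>x\<in>Hom C T (Dom C f). \<forall>y\<in>Hom C T (Dom C f). f \<cdot>\<^bsub>C\<^esub> x = f \<cdot>\<^bsub>C\<^esub> y \<longrightarrow> x = y)"

definition is_epi :: "('o, 'm) cat \<Rightarrow> 'm \<Rightarrow> bool" where
  "is_epi C f \<longleftrightarrow> f \<in> Arr C \<and>
     (\<forall>T. \<forall>x\<in>Hom C (Cod C f) T. \<forall>y\<in>Hom C (Cod C f) T. x \<cdot>\<^bsub>C\<^esub> f = y \<cdot>\<^bsub>C\<^esub> f \<longrightarrow> x = y)"

definition is_product :: "('o, 'm) cat \<Rightarrow> 'o \<Rightarrow> 'o \<Rightarrow> 'o \<Rightarrow> 'm \<Rightarrow> 'm \<Rightarrow> bool" where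
  "is_product C A B P p q \<longleftrightarrow> p \<in> Hom C P A \<and> q \<in> Hom C P B \<and>
     (\<forall>T\<in>Obj C. \<forall>x\<in>Hom C T A. \<forall>y\<in>Hom C T B.
        \<exists>!h. h \<in> Hom C T P \<and> p \<cdot>\<^bsub>C\<^esub> h = x \<and> q \<cdot>\<^bsub>C\<^esub> h = y)"

text \<open>The kernel object is \<open>Dom C k\<close>, the cokernel object is \<open>Cod C q\<close>.\<close>

definition is_kernel :: "('o, 'm) cat \<Rightarrow> 'm \<Rightarrow> 'm \<Rightarrow> bool" where
  "is_kernel C k u \<longleftrightarrow> k \<in> Arr C \<and> u \<in> Arr C \<and> Cod C k = Dom C u \<and>
     u \<cdot>\<^bsub>C\<^esub> k = Zero C (Dom C k) (Cod C u) \<and>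
     (\<forall>T. \<forall>t\<in>Hom C T (Dom C u). u \<cdot>\<^bsub>C\<^esub> t = Zero C T (Cod C u) \<longrightarrow>
        (\<exists>!s. s \<in> Hom C T (Dom C k) \<and> k \<cdot>\<^bsub>C\<^esub> s = t))"

definition is_cokernel :: "('o, 'm) cat \<Rightarrow> 'm \<Rightarrow> 'm \<Rightarrow> bool" where
  "is_cokernel C q u \<longleftrightarrow> q \<in> Arr C \<and> u \<in> Arr C \<and> Dom C q = Cod C u \<and>
     q \<cdot>\<^bsub>C\<^esub> u = Zero C (Dom C u) (Cod C q) \<and>
     (\<forall>T. \<forall>t\<in>Hom C (Cod C u) T. t \<cdot>\<^bsub>C\<^esub> u = Zero C (Dom C u) T \<longrightarrow>
        (\<exists>!s. s \<in> Hom C (Cod C q) T \<and> s \<cdot>\<^bsub>C\<^esub> q = t))"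

text \<open>Here \<open>q\<close> is the cokernel of the kernel of \<open>u\<close>, \<open>m\<close> is the kernel of its cokernel, and
  \<open>w\<close> is the canonical morphism, determined by \<open>u = m \<cdot> w \<cdot> q\<close>.\<close>

definition is_strict :: "('o, 'm) cat \<Rightarrow> 'm \<Rightarrow> bool" where
  "is_strict C u \<longleftrightarrow>
     (\<exists>k q c m w. is_kernel C k u \<and> is_cokernel C q k \<and> is_cokernel C c u \<and> is_kernel C m c \<and>
        w \<in> Hom C (Cod C q) (Dom C m) \<and> m \<cdot>\<^bsub>C\<^esub> w \<cdot>\<^bsub>C\<^esub> q = u \<and> is_isomorphism C w)"

definition is_strict_mono :: "('o, 'm) cat \<Rightarrow> 'm \<Rightarrow> bool" where
  "is_strict_mono C u \<longleftrightarrow> is_mono C u \<and> is_strict C u"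

definition is_strict_epi :: "('o, 'm) cat \<Rightarrow> 'm \<Rightarrow> bool" where
  "is_strict_epi C u \<longleftrightarrow> is_epi C u \<and> is_strict C u"

text \<open>Square \<open>a \<cdot> \<alpha> = b \<cdot> \<beta>\<close> with \<open>\<alpha> : K \<rightarrow> A\<close>, \<open>\<beta> : K \<rightarrow> B\<close>, \<open>a : A \<rightarrow> P\<close>, \<open>b : B \<rightarrow> P\<close>,
  where \<open>P\<close> is the pushout.\<close>

definition is_pushout :: "('o, 'm) cat \<Rightarrow> 'm \<Rightarrow> 'm \<Rightarrow> 'm \<Rightarrow> 'm \<Rightarrow> bool" where
  "is_pushout C \<alpha> \<beta> a b \<longleftrightarrow> \<alpha> \<in> Arr C \<and> \<beta> \<in> Arr C \<and> Dom C \<alpha> = Dom C \<beta> \<and>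
     a \<in> Hom C (Cod C \<alpha>) (Cod C b) \<and> b \<in> Hom C (Cod C \<beta>) (Cod C a) \<and>
     a \<cdot>\<^bsub>C\<^esub> \<alpha> = b \<cdot>\<^bsub>C\<^esub> \<beta> \<and>
     (\<forall>T. \<forall>x\<in>Hom C (Cod C \<alpha>) T. \<forall>y\<in>Hom C (Cod C \<beta>) T. x \<cdot>\<^bsub>C\<^esub> \<alpha> = y \<cdot>\<^bsub>C\<^esub> \<beta> \<longrightarrow>
        (\<exists>!h. h \<in> Hom C (Cod C a) T \<and> h \<cdot>\<^bsub>C\<^esub> a = x \<and> h \<cdot>\<^bsub>C\<^esub> b = y))"

text \<open>Square \<open>f \<cdot> a = g \<cdot> b\<close> with \<open>f : A \<rightarrow> K\<close>, \<open>g : B \<rightarrow> K\<close>, \<open>a : P \<rightarrow> A\<close>, \<open>b : P \<rightarrow> B\<close>,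
  where \<open>P\<close> is the pullback.\<close>

definition is_pullback :: "('o, 'm) cat \<Rightarrow> 'm \<Rightarrow> 'm \<Rightarrow> 'm \<Rightarrow> 'm \<Rightarrow> bool" where
  "is_pullback C f g a b \<longleftrightarrow> f \<in> Arr C \<and> g \<in> Arr C \<and> Cod C f = Cod C g \<and>
     a \<in> Hom C (Dom C b) (Dom C f) \<and> b \<in> Hom C (Dom C a) (Dom C g) \<and>
     f \<cdot>\<^bsub>C\<^esub> a = g \<cdot>\<^bsub>C\<^esub> b \<and>
     (\<forall>T. \<forall>x\<in>Hom C T (Dom C f). \<forall>y\<in>Hom C T (Dom C g). f \<cdot>\<^bsub>C\<^esub> x = g \<cdot>\<^bsub>C\<^esub> y \<longrightarrow>
        (\<exists>!h. h \<in> Hom C T (Dom C a) \<and> a \<cdot>\<^bsub>C\<^esub> h = x \<and> b \<cdot>\<^bsub>C\<^esub> h = y))"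

locale category =
  fixes C :: "('o, 'm) cat" (structure)
  assumes Dom_Obj: "f \<in> Arr C \<Longrightarrow> Dom C f \<in> Obj C"
    and Cod_Obj: "f \<in> Arr C \<Longrightarrow> Cod C f \<in> Obj C"
    and Idm_Hom: "A \<in> Obj C \<Longrightarrow> Idm C A \<in> Hom C A A"
    and Comp_Hom: "\<lbrakk>f \<in> Hom C A B; g \<in> Hom C B E\<rbrakk> \<Longrightarrow> g \<cdot> f \<in> Hom C A E"
    and Comp_Idm: "f \<in> Hom C A B \<Longrightarrow> f \<cdot> Idm C A = f"
    and Idm_Comp: "f \<in> Hom C A B \<Longrightarrow> Idm C B \<cdot> f = f"
    and Comp_assoc: "\<lbrakk>f \<in> Hom C A B; g \<in> Hom C B E; h \<in> Hom C E F\<rbrakk>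
                       \<Longrightarrow> (h \<cdot> g) \<cdot> f = h \<cdot> (g \<cdot> f)"

locale additive_category = category +
  assumes Hom_comm_group: "\<lbrakk>A \<in> Obj C; B \<in> Obj C\<rbrakk> \<Longrightarrow> comm_group (Hom_group C A B)"
    and Comp_Add: "\<lbrakk>f \<in> Hom C A B; g \<in> Hom C A B; h \<in> Hom C B E\<rbrakk>
                     \<Longrightarrow> h \<cdot> Add C f g = Add C (h \<cdot> f) (h \<cdot> g)"
    and Add_Comp: "\<lbrakk>f \<in> Hom C A B; g \<in> Hom C B E; h \<in> Hom C B E\<rbrakk>
                     \<Longrightarrow> Add C g h \<cdot> f = Add C (g \<cdot> f) (h \<cdot> f)"
    and zero_object_ex: "\<exists>Z. is_zero_object C Z"
    and product_ex: "\<lbrakk>A \<in> Obj C; B \<in> Obj C\<rbrakk> \<Longrightarrow> \<exists>P p q. is_product C A B P p q"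

locale preabelian_category = additive_category +
  assumes kernel_ex: "u \<in> Arr C \<Longrightarrow> \<exists>k. is_kernel C k u"
    and cokernel_ex: "u \<in> Arr C \<Longrightarrow> \<exists>q. is_cokernel C q u"

text \<open>Pushouts and pullbacks exist in every pre-abelian category and are unique up to isomorphism,
  so it does not matter that the two axioms quantify over all of them.\<close>

locale special_preabelian_category = preabelian_category +
  assumes pushout_strict_mono:
      "\<lbrakk>is_strict_mono C \<alpha>; is_pushout C \<alpha> \<beta> a b\<rbrakk> \<Longrightarrow> is_strict_mono C b"
    and pullback_strict_epi:
      "\<lbrakk>is_strict_epi C f; is_pullback C f g a b\<rbrakk> \<Longrightarrow> is_strict_epi C b"

definition pairing :: "('o, 'm) cat \<Rightarrow> 'o \<Rightarrow> 'm \<Rightarrow> 'm \<Rightarrow> 'm \<Rightarrow> 'm \<Rightarrow> 'm" where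
  "pairing C P p q x y =
     (THE h. h \<in> Hom C (Dom C x) P \<and> p \<cdot>\<^bsub>C\<^esub> h = x \<and> q \<cdot>\<^bsub>C\<^esub> h = y)"

text \<open>The object \<open>A\<close> with multiplication \<open>\<mu> : A \<times> A \<rightarrow> A\<close>, unit \<open>e : Z \<rightarrow> A\<close> (\<open>Z\<close> terminal) and
  inversion \<open>v : A \<rightarrow> A\<close>, where \<open>P\<close> with projections \<open>p\<close>, \<open>q\<close> is the product \<open>A \<times> A\<close>.  The
  commutative diagrams are expressed on generalized elements \<open>T \<rightarrow> A\<close>.\<close>

definition is_comm_group_object ::
  "('o, 'm) cat \<Rightarrow> 'o \<Rightarrow> 'o \<Rightarrow> 'm \<Rightarrow> 'm \<Rightarrow> 'o \<Rightarrow> 'm \<Rightarrow> 'm \<Rightarrow> 'm \<Rightarrow> bool" where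
  "is_comm_group_object C A P p q Z \<mu> e v \<longleftrightarrow>
     is_product C A A P p q \<and> is_zero_object C Z \<and>
     \<mu> \<in> Hom C P A \<and> e \<in> Hom C Z A \<and> v \<in> Hom C A A \<and>
     (\<forall>T\<in>Obj C. \<forall>x\<in>Hom C T A. \<forall>y\<in>Hom C T A. \<forall>z\<in>Hom C T A. \<forall>t\<in>Hom C T Z.
        let mul = (\<lambda>a b. \<mu> \<cdot>\<^bsub>C\<^esub> pairing C P p q a b) in
          mul (mul x y) z = mul x (mul y z) \<and> mul x y = mul y x \<and>
          mul (e \<cdot>\<^bsub>C\<^esub> t) x = x \<and> mul (v \<cdot>\<^bsub>C\<^esub> x) x = e \<cdot>\<^bsub>C\<^esub> t)"

text \<open>In an additive category such structures always exist, with \<open>\<mu>\<close> the sum of the two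
  projections; the condition is nevertheless kept as an explicit one.\<close>

definition consists_of_group_objects :: "('o, 'm) cat \<Rightarrow> bool" where
  "consists_of_group_objects C \<longleftrightarrow>
     (\<exists>P p q Z \<mu> e v.
        (\<forall>A\<in>Obj C. is_comm_group_object C A (P A) (p A) (q A) Z (\<mu> A) (e A) (v A)) \<and>
        (\<forall>A B. \<forall>f\<in>Hom C A B.
           f \<cdot>\<^bsub>C\<^esub> \<mu> A = \<mu> B \<cdot>\<^bsub>C\<^esub> pairing C (P B) (p B) (q B) (f \<cdot>\<^bsub>C\<^esub> p A) (f \<cdot>\<^bsub>C\<^esub> q A)))"

definition full_subcategory :: "('o, 'm) cat \<Rightarrow> 'o set \<Rightarrow> ('o, 'm) cat" where
  "full_subcategory C X =
     C\<lparr>Obj := Obj C \<inter> X, Arr := {f \<in> Arr C. Dom C f \<in> X \<and> Cod C f \<in> X}\<rparr>"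

definition killed_by :: "('o, 'm) cat \<Rightarrow> nat \<Rightarrow> 'o \<Rightarrow> bool" where
  "killed_by C n A \<longleftrightarrow> nat_mult C n (Idm C A) = Zero C A A"

definition torsion_subcategory :: "('o, 'm) cat \<Rightarrow> nat \<Rightarrow> ('o, 'm) cat" where
  "torsion_subcategory C n = full_subcategory C {A. killed_by C n A}"

definition short_exact :: "('o, 'm) cat \<Rightarrow> 'm \<Rightarrow> 'm \<Rightarrow> bool" where
  "short_exact C i j \<longleftrightarrow> is_kernel C i j \<and> is_cokernel C j i"

text \<open>A short exact sequence splits if its epimorphism \<open>j\<close> has a section.\<close>

definition splits :: "('o, 'm) cat \<Rightarrow> 'm \<Rightarrow> bool" where
  "splits C j \<longleftrightarrow> (\<exists>s\<in>Hom C (Cod C j) (Dom C j). j \<cdot>\<^bsub>C\<^esub> s = Idm C (Cod C j))"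

definition extensions :: "('o, 'm) cat \<Rightarrow> 'o \<Rightarrow> 'o \<Rightarrow> ('m \<times> 'm) set" where
  "extensions C A2 A1 = {(i, j). short_exact C i j \<and> Dom C i = A1 \<and> Cod C j = A2}"

text \<open>In a special pre-abelian category every morphism \<open>h\<close> as below is automatically an
  isomorphism.\<close>

definition extension_equiv ::
  "('o, 'm) cat \<Rightarrow> 'o \<Rightarrow> 'o \<Rightarrow> (('m \<times> 'm) \<times> ('m \<times> 'm)) set" where
  "extension_equiv C A2 A1 =
     {((i, j), (i', j')). (i, j) \<in> extensions C A2 A1 \<and> (i', j') \<in> extensions C A2 A1 \<and>
        (\<exists>h\<in>Hom C (Cod C i) (Cod C i'). is_isomorphism C h \<and> h \<cdot>\<^bsub>C\<^esub> i = i' \<and> j' \<cdot>\<^bsub>C\<^esub> h = j)}"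

definition Ext :: "('o, 'm) cat \<Rightarrow> 'o \<Rightarrow> 'o \<Rightarrow> ('m \<times> 'm) set set" where
  "Ext C A2 A1 = extensions C A2 A1 // extension_equiv C A2 A1"

text \<open>\<open>Ext\<close> vanishes if every extension in every class splits.\<close>

definition Ext_eq_zero :: "('o, 'm) cat \<Rightarrow> 'o \<Rightarrow> 'o \<Rightarrow> bool" where
  "Ext_eq_zero C A2 A1 \<longleftrightarrow> (\<forall>c\<in>Ext C A2 A1. \<forall>(i, j)\<in>c. splits C j)"

text \<open>\<open>comp_from C X i m k\<close> is \<open>i (m + k - 1) \<cdot> \<dots> \<cdot> i m : X m \<rightarrow> X (m + k)\<close>.\<close>

primrec comp_from :: "('o, 'm) cat \<Rightarrow> (nat \<Rightarrow> 'o) \<Rightarrow> (nat \<Rightarrow> 'm) \<Rightarrow> nat \<Rightarrow> nat \<Rightarrow> 'm" where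
  "comp_from C X i m 0 = Idm C (X m)"
| "comp_from C X i m (Suc k) = i (m + k) \<cdot>\<^bsub>C\<^esub> comp_from C X i m k"

definition transition :: "('o, 'm) cat \<Rightarrow> (nat \<Rightarrow> 'o) \<Rightarrow> (nat \<Rightarrow> 'm) \<Rightarrow> nat \<Rightarrow> nat \<Rightarrow> 'm" where
  "transition C X i m n = comp_from C X i m (n - m)"

definition is_p_divisible_group ::
  "nat \<Rightarrow> ('o, 'm) cat \<Rightarrow> (nat \<Rightarrow> 'o) \<Rightarrow> (nat \<Rightarrow> 'm) \<Rightarrow> bool" where
  "is_p_divisible_group p C X i \<longleftrightarrow>
     (\<forall>n. X n \<in> Obj C) \<and> is_zero_object C (X 0) \<and>
     (\<forall>n. i n \<in> Hom C (X n) (X (Suc n)) \<and> is_strict_mono C (i n)) \<and>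
     (\<forall>m n. m \<le> n \<longrightarrow>
        (\<exists>j\<in>Hom C (X n) (X (n - m)).
           short_exact C (transition C X i m n) j \<and>
           transition C X i (n - m) n \<cdot>\<^bsub>C\<^esub> j = nat_mult C (p ^ m) (Idm C (X n))))"

end

theory Submission
  imports Defs
begin

text \<open>Any isomorphism \<open>f : C(n) \<rightarrow> C\<^sub>1(n)\<close> with \<open>n \<ge> 1\<close> extends to the next level.  Let \<open>G\<close> be the
  pullback of \<open>C\<^sub>1(n+1) \<rightarrow> C\<^sub>1(n)\<close> along \<open>C(n+1) \<rightarrow> C(n) \<rightarrow> C\<^sub>1(n)\<close>; it is an extension of \<open>C(n+1)\<close> by
  \<open>C\<^sub>1(1)\<close>, and \<open>\<sigma> = (i, i\<^sub>1 f) : C(n) \<rightarrow> G\<close> is a section of it over \<open>C(n)\<close>.  The cokernel \<open>H\<close> of \<open>\<sigma>\<close>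
  is an extension of \<open>C(1)\<close> by \<open>C\<^sub>1(1)\<close>.  Multiplication by \<open>p\<close> on \<open>C(n+1)\<close> and \<open>C\<^sub>1(n+1)\<close> factors
  through \<open>i\<close> and \<open>i\<^sub>1\<close>, so on \<open>G\<close> it factors through \<open>\<sigma>\<close>; hence \<open>H\<close> is killed by \<open>p\<close> and splits by
  hypothesis.  The splitting yields a section of \<open>G \<rightarrow> C(n+1)\<close> that extends \<open>\<sigma>\<close>, and its second
  component extends \<open>i\<^sub>1 f\<close>.  Extending \<open>f\<close> and its inverse in this way gives two morphisms whose
  composites are the identity up to an endomorphism of square zero, so they are isomorphisms.\<close>

section \<open>Categories\<close>

context category
begin

lemma in_Hom_iff: "f \<in> Hom C A B \<longleftrightarrow> f \<in> Arr C \<and> Dom C f = A \<and> Cod C f = B"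
  by (simp add: Hom_def)

lemma Hom_Obj:
  assumes "f \<in> Hom C A B"
  shows "A \<in> Obj C" "B \<in> Obj C"
  using assms Dom_Obj Cod_Obj by (auto simp: Hom_def)

text \<open>The middle object of \<open>Comp_Hom\<close> does not occur in its conclusion. Phrased
  with \<open>Dom\<close> and \<open>Cod\<close>, the side conditions can be discharged by
  rewriting.\<close>

lemma Comp_Arr:
  assumes "f \<in> Arr C" "g \<in> Arr C" "Dom C g = Cod C f"
  shows "g \<cdot> f \<in> Arr C" "Dom C (g \<cdot> f) = Dom C f" "Cod C (g \<cdot> f) = Cod C g"
  using Comp_Hom[of f "Dom C f" "Cod C f" g "Cod C g"] assms by (auto simp: Hom_def)

lemma Comp_Arr_assoc:
  assumes "f \<in> Arr C" "g \<in> Arr C" "h \<in> Arr C" "Dom C g = Cod C f" "Dom C h = Cod C g"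
  shows "(h \<cdot> g) \<cdot> f = h \<cdot> g \<cdot> f"
  using Comp_assoc[of f "Dom C f" "Cod C f" g "Cod C g" h "Cod C h"] assms by (auto simp: Hom_def)

lemma Idm_Arr:
  assumes "A \<in> Obj C"
  shows "Idm C A \<in> Arr C" "Dom C (Idm C A) = A" "Cod C (Idm C A) = A"
  using Idm_Hom[OF assms] by (auto simp: Hom_def)

lemma Idm_Arr_comp:
  assumes "f \<in> Arr C"
  shows "Cod C f = A \<Longrightarrow> Idm C A \<cdot> f = f" "Dom C f = A \<Longrightarrow> f \<cdot> Idm C A = f"
  using Comp_Idm[of f "Dom C f" "Cod C f"] Idm_Comp[of f "Dom C f" "Cod C f"] assms
  by (auto simp: Hom_def)

text \<open>These unfold \<open>Hom\<close> into conditions on \<open>Dom\<close> and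
  \<open>Cod\<close> and bracket every composite to the right, which settles equations that hold by
  associativity alone.\<close>

lemmas arr_simps = in_Hom_iff Comp_Arr Comp_Arr_assoc Idm_Arr Idm_Arr_comp Dom_Obj Cod_Obj

section \<open>Isomorphisms and isomorphic objects\<close>

lemma isomorphismI:
  assumes "f \<in> Hom C A B" "g \<in> Hom C B A" "g \<cdot> f = Idm C A" "f \<cdot> g = Idm C B"
  shows "is_isomorphism C f"
  using assms unfolding is_isomorphism_def by (auto simp: Hom_def)

lemma isomorphismE:
  assumes "is_isomorphism C f" "f \<in> Hom C A B"
  obtains g where "g \<in> Hom C B A" "g \<cdot> f = Idm C A" "f \<cdot> g = Idm C B"
  using assms unfolding is_isomorphism_def by (auto simp: Hom_def)

lemma isomorphic_sym:
  assumes "isomorphic C A B"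
  shows "isomorphic C B A"
proof -
  obtain f where f: "f \<in> Hom C A B" "is_isomorphism C f"
    using assms by (auto simp: isomorphic_def)
  then obtain g where "g \<in> Hom C B A" "g \<cdot> f = Idm C A" "f \<cdot> g = Idm C B"
    by (metis isomorphismE)
  then show ?thesis
    using f isomorphismI unfolding isomorphic_def by blast
qed

lemma isomorphic_trans:
  assumes "isomorphic C A B" "isomorphic C B E"
  shows "isomorphic C A E"
proof -
  obtain f where f: "f \<in> Hom C A B" "is_isomorphism C f"
    using assms by (auto simp: isomorphic_def)
  obtain g where g: "g \<in> Hom C B E" "is_isomorphism C g"
    using assms by (auto simp: isomorphic_def)
  obtain f' where f': "f' \<in> Hom C B A" "f' \<cdot> f = Idm C A" "f \<cdot> f' = Idm C B"
    using f by (metis isomorphismE)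
  obtain g' where g': "g' \<in> Hom C E B" "g' \<cdot> g = Idm C B" "g \<cdot> g' = Idm C E"
    using g by (metis isomorphismE)
  have h: "g \<cdot> f \<in> Hom C A E" "f' \<cdot> g' \<in> Hom C E A"
    using f(1) g(1) f'(1) g'(1) Comp_Hom by blast+
  have "(f' \<cdot> g') \<cdot> g \<cdot> f = f' \<cdot> (g' \<cdot> g) \<cdot> f" "(g \<cdot> f) \<cdot> f' \<cdot> g' = g \<cdot> (f \<cdot> f') \<cdot> g'"
    using f(1) g(1) f'(1) g'(1) by (simp_all add: arr_simps)
  then have "(f' \<cdot> g') \<cdot> g \<cdot> f = Idm C A" "(g \<cdot> f) \<cdot> f' \<cdot> g' = Idm C E"
    using f(1) g(1) f' g' Idm_Comp by metis+
  then have "is_isomorphism C (g \<cdot> f)"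
    using h isomorphismI by metis
  then show ?thesis
    using f(1) g(1) Comp_Hom unfolding isomorphic_def by blast
qed

section \<open>Cancellation laws and the universal property of pullbacks\<close>

lemma is_monoD:
  assumes "is_mono C f" "f \<in> Hom C A B" "x \<in> Hom C T A" "y \<in> Hom C T A" "f \<cdot> x = f \<cdot> y"
  shows "x = y"
proof -
  have "Dom C f = A" using assms(2) by (simp add: Hom_def)
  then show ?thesis using assms unfolding is_mono_def by blast
qed

lemma is_epiD:
  assumes "is_epi C f" "f \<in> Hom C A B" "x \<in> Hom C B T" "y \<in> Hom C B T" "x \<cdot> f = y \<cdot> f"
  shows "x = y"
proof -
  have "Cod C f = B" using assms(2) by (simp add: Hom_def)
  then show ?thesis using assms unfolding is_epi_def by blast
qed

lemma pullback_lift: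
  assumes "is_pullback C f g a b" "a \<in> Hom C P A" "b \<in> Hom C P B"
    "x \<in> Hom C T A" "y \<in> Hom C T B" "f \<cdot> x = g \<cdot> y"
  obtains h where "h \<in> Hom C T P" "a \<cdot> h = x" "b \<cdot> h = y"
proof -
  have "a \<in> Hom C (Dom C b) (Dom C f)" "b \<in> Hom C (Dom C a) (Dom C g)"
    using assms(1) unfolding is_pullback_def by blast+
  then have "Dom C f = A" "Dom C g = B" "Dom C a = P"
    using assms(2,3) unfolding Hom_def mem_Collect_eq by metis+
  then have "\<exists>!h. h \<in> Hom C T P \<and> a \<cdot> h = x \<and> b \<cdot> h = y"
    using assms unfolding is_pullback_def by blast
  then show ?thesis using that by blast
qed

text \<open>As \<open>f \<cdot> a = g \<cdot> b\<close>, the pair \<open>a \<cdot> h\<close>,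
  \<open>b \<cdot> h\<close> is compatible; both \<open>h\<close> and \<open>h'\<close> induce it,
  and the universal property allows only one such morphism.\<close>

lemma pullback_cancel:
  assumes "is_pullback C f g a b" "a \<in> Hom C P A" "b \<in> Hom C P B"
    "h \<in> Hom C T P" "h' \<in> Hom C T P" "a \<cdot> h = a \<cdot> h'" "b \<cdot> h = b \<cdot> h'"
  shows "h = h'"
proof -
  have fg: "f \<in> Arr C" "g \<in> Arr C" "Cod C f = Cod C g" "f \<cdot> a = g \<cdot> b"
    and "a \<in> Hom C (Dom C b) (Dom C f)" "b \<in> Hom C (Dom C a) (Dom C g)"
    using assms(1) unfolding is_pullback_def by blast+
  then have d: "Dom C f = A" "Dom C g = B" "Dom C a = P"
    using assms(2,3) unfolding Hom_def mem_Collect_eq by metis+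
  have "f \<in> Hom C A (Cod C g)" "g \<in> Hom C B (Cod C g)"
    using fg d by (simp_all add: Hom_def)
  then have "f \<cdot> a \<cdot> h = g \<cdot> b \<cdot> h"
    using Comp_assoc[OF assms(4,2)] Comp_assoc[OF assms(4,3)] fg(4) by metis
  moreover have "a \<cdot> h \<in> Hom C T A" "b \<cdot> h \<in> Hom C T B"
    using assms Comp_Hom by blast+
  ultimately have "\<exists>!k. k \<in> Hom C T P \<and> a \<cdot> k = a \<cdot> h \<and> b \<cdot> k = b \<cdot> h"
    using assms(1) d unfolding is_pullback_def by blast
  then show ?thesis using assms by metis
qed

end

section \<open>Additive and pre-abelian categories\<close>

context additive_category
begin

text \<open>The Hom group is read off from \<open>g\<close>, so that no objects have to be passed;
  this is the usual difference when \<open>f\<close> and \<open>g\<close> are parallel.\<close>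

definition sub (infixl "\<ominus>\<ominus>" 65) where
  "f \<ominus>\<ominus> g = Add C f (inv\<^bsub>Hom_group C (Dom C g) (Cod C g)\<^esub> g)"

context
  fixes A B
  assumes AB: "A \<in> Obj C" "B \<in> Obj C"
begin

interpretation HG: comm_group "Hom_group C A B"
  by (rule Hom_comm_group[OF AB])

lemma Zero_Hom: "Zero C A B \<in> Hom C A B"
  using HG.one_closed by (simp add: Hom_group_def)

end

context
  fixes A B f g
  assumes f: "f \<in> Hom C A B" and g: "g \<in> Hom C A B"
begin

interpretation HG: comm_group "Hom_group C A B"
  using Hom_comm_group[of A B] Hom_Obj[OF f] by simp

lemma Add_Hom: "Add C f g \<in> Hom C A B"
  using HG.m_closed[of f g] f g by (simp add: Hom_group_def)

lemma Add_commute: "Add C f g = Add C g f"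
  using HG.m_comm[of f g] f g by (simp add: Hom_group_def)

lemma Zero_Add: "Add C (Zero C A B) f = f"
  using HG.l_one[of f] f by (simp add: Hom_group_def)

lemma Add_Zero: "Add C f (Zero C A B) = f"
  using HG.r_one[of f] f by (simp add: Hom_group_def)

lemma sub_Hom: "f \<ominus>\<ominus> g \<in> Hom C A B"
  using HG.m_closed[of f "inv\<^bsub>Hom_group C A B\<^esub> g"] HG.inv_closed[of g] f g
  by (simp add: Hom_group_def sub_def Hom_def)

lemma sub_Add_cancel: "Add C (f \<ominus>\<ominus> g) g = f"
  using HG.m_assoc[of f "inv\<^bsub>Hom_group C A B\<^esub> g" g] HG.inv_closed[of g] HG.l_inv[of g]
    HG.r_one[of f] f g
  by (simp add: Hom_group_def sub_def Hom_def)

lemma Add_right_cancel: "\<lbrakk>h \<in> Hom C A B; Add C f h = Add C g h\<rbrakk> \<Longrightarrow> f = g"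
  using HG.right_cancel[of h f g] f g by (simp add: Hom_group_def)

lemma sub_self: "f \<ominus>\<ominus> f = Zero C A B"
  using HG.r_inv[of f] f by (simp add: Hom_group_def sub_def Hom_def)

end

lemma sub_eq_iff:
  assumes "f \<in> Hom C A B" "g \<in> Hom C A B" "h \<in> Hom C A B"
  shows "f \<ominus>\<ominus> g = h \<longleftrightarrow> f = Add C h g"
  using sub_Add_cancel[OF assms(1,2)] Add_right_cancel[OF sub_Hom[OF assms(1,2)] assms(3,2)] by auto

lemma sub_Zero:
  assumes "f \<in> Hom C A B"
  shows "f \<ominus>\<ominus> Zero C A B = f"
  using assms sub_eq_iff Add_Zero Zero_Hom Hom_Obj by metis

text \<open>Zero is its own double, hence so is its composite with \<open>h\<close>, and
  cancellation in the Hom group leaves zero.\<close>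

lemma Comp_Zero:
  assumes "h \<in> Hom C B E" "A \<in> Obj C"
  shows "h \<cdot> Zero C A B = Zero C A E"
proof -
  have o: "B \<in> Obj C" "E \<in> Obj C" using assms Hom_Obj by auto
  have z: "Zero C A B \<in> Hom C A B" "Zero C A E \<in> Hom C A E"
    using o assms Zero_Hom by auto
  then have hz: "h \<cdot> Zero C A B \<in> Hom C A E" using assms Comp_Hom by blast
  have "Add C (h \<cdot> Zero C A B) (h \<cdot> Zero C A B) = Add C (Zero C A E) (h \<cdot> Zero C A B)"
    using Comp_Add[OF z(1) z(1) assms(1)] Add_Zero[OF z(1) z(1)] Zero_Add[OF hz hz] by simp
  then show ?thesis
    using Add_right_cancel[OF hz z(2) hz] by simp
qed

lemma Zero_Comp:
  assumes "f \<in> Hom C A B" "E \<in> Obj C"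
  shows "Zero C B E \<cdot> f = Zero C A E"
proof -
  have o: "A \<in> Obj C" "B \<in> Obj C" using assms Hom_Obj by auto
  have z: "Zero C B E \<in> Hom C B E" "Zero C A E \<in> Hom C A E"
    using o assms Zero_Hom by auto
  then have hz: "Zero C B E \<cdot> f \<in> Hom C A E" using assms Comp_Hom by blast
  have "Add C (Zero C B E \<cdot> f) (Zero C B E \<cdot> f) = Add C (Zero C A E) (Zero C B E \<cdot> f)"
    using Add_Comp[OF assms(1) z(1) z(1)] Add_Zero[OF z(1) z(1)] Zero_Add[OF hz hz] by simp
  then show ?thesis
    using Add_right_cancel[OF hz z(2) hz] by simp
qed

text \<open>Distributivity over sums is applied to \<open>f\<close> written as the difference plus
  \<open>g\<close>.\<close>

lemma Comp_sub:
  assumes "f \<in> Hom C A B" "g \<in> Hom C A B" "h \<in> Hom C B E"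
  shows "h \<cdot> (f \<ominus>\<ominus> g) = h \<cdot> f \<ominus>\<ominus> h \<cdot> g"
  using sub_eq_iff[OF Comp_Hom[OF assms(1,3)] Comp_Hom[OF assms(2,3)]
      Comp_Hom[OF sub_Hom[OF assms(1,2)] assms(3)]]
    Comp_Add[OF sub_Hom[OF assms(1,2)] assms(2,3)] sub_Add_cancel[OF assms(1,2)]
  by simp

lemma sub_Comp:
  assumes "f \<in> Hom C A B" "g \<in> Hom C B E" "h \<in> Hom C B E"
  shows "(g \<ominus>\<ominus> h) \<cdot> f = g \<cdot> f \<ominus>\<ominus> h \<cdot> f"
  using sub_eq_iff[OF Comp_Hom[OF assms(1,2)] Comp_Hom[OF assms(1,3)]
      Comp_Hom[OF assms(1) sub_Hom[OF assms(2,3)]]]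
    Add_Comp[OF assms(1) sub_Hom[OF assms(2,3)] assms(3)] sub_Add_cancel[OF assms(2,3)]
  by simp

lemma sub_eq_Zero:
  assumes "f \<in> Hom C A B" "g \<in> Hom C A B" "f \<ominus>\<ominus> g = Zero C A B"
  shows "f = g"
  using assms sub_Add_cancel Zero_Add by metis

section \<open>Natural multiples of morphisms\<close>

lemma nat_mult_Suc: "nat_mult C (Suc n) f = Add C (nat_mult C n f) f"
  by (simp add: nat_mult_def Hom_group_def)

lemma nat_mult_0: "f \<in> Hom C A B \<Longrightarrow> nat_mult C 0 f = Zero C A B"
  by (simp add: nat_mult_def Hom_group_def Hom_def)

lemma nat_mult_Hom: "f \<in> Hom C A B \<Longrightarrow> nat_mult C n f \<in> Hom C A B"
  by (induction n) (auto simp: nat_mult_0 nat_mult_Suc intro: Zero_Hom Add_Hom Hom_Obj)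

lemma Comp_nat_mult:
  assumes "f \<in> Hom C A B" "h \<in> Hom C B E"
  shows "h \<cdot> nat_mult C n f = nat_mult C n (h \<cdot> f)"
proof (induction n)
  case 0
  then show ?case
    using assms Comp_Zero Comp_Hom Hom_Obj nat_mult_0 by metis
next
  case (Suc n)
  then show ?case
    using assms Comp_Add[OF nat_mult_Hom[of f A B n] assms] by (simp add: nat_mult_Suc)
qed

lemma nat_mult_Comp:
  assumes "f \<in> Hom C A B" "g \<in> Hom C B E"
  shows "nat_mult C n g \<cdot> f = nat_mult C n (g \<cdot> f)"
proof (induction n)
  case 0
  then show ?case
    using assms Zero_Comp Comp_Hom Hom_Obj nat_mult_0 by metis
next
  case (Suc n)
  then show ?case
    using assms Add_Comp[OF assms(1) nat_mult_Hom[of g B E n] assms(2)] by (simp add: nat_mult_Suc)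
qed

text \<open>Both composites equal \<open>nat_mult C n f\<close>: multiplication by \<open>n\<close>
  is a natural endomorphism of the identity functor.\<close>

lemma nat_mult_Idm_commute:
  assumes "f \<in> Hom C A B"
  shows "f \<cdot> nat_mult C n (Idm C A) = nat_mult C n (Idm C B) \<cdot> f"
  using assms Comp_nat_mult[of "Idm C A" A A f B n] nat_mult_Comp[of f A B "Idm C B" B n]
  by (simp add: Idm_Hom Hom_Obj Comp_Idm Idm_Comp)

section \<open>Universal properties of kernels and cokernels\<close>

lemma kernelI:
  assumes "k \<in> Hom C K A" "u \<in> Hom C A B" "u \<cdot> k = Zero C K B"
    and "\<And>T t. \<lbrakk>t \<in> Hom C T A; u \<cdot> t = Zero C T B\<rbrakk> \<Longrightarrow> \<exists>s\<in>Hom C T K. k \<cdot> s = t"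
    and "\<And>T x y. \<lbrakk>x \<in> Hom C T K; y \<in> Hom C T K; k \<cdot> x = k \<cdot> y\<rbrakk> \<Longrightarrow> x = y"
  shows "is_kernel C k u"
proof -
  have d: "k \<in> Arr C" "u \<in> Arr C" "Dom C k = K" "Cod C k = A" "Dom C u = A" "Cod C u = B"
    using assms by (auto simp: Hom_def)
  have "\<exists>!s. s \<in> Hom C T K \<and> k \<cdot> s = t" if "t \<in> Hom C T A" "u \<cdot> t = Zero C T B" for T t
    using assms(4)[OF that] assms(5) by metis
  then show ?thesis
    using d assms(3) by (simp add: is_kernel_def)
qed

lemma kernelD:
  assumes "is_kernel C k u"
  shows "k \<in> Hom C (Dom C k) (Dom C u)" "u \<in> Hom C (Dom C u) (Cod C u)"
    "u \<cdot> k = Zero C (Dom C k) (Cod C u)"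
  using assms by (auto simp: is_kernel_def Hom_def)

lemma kernel_lift:
  assumes "is_kernel C k u" "k \<in> Hom C K A" "u \<in> Hom C A B" "t \<in> Hom C T A" "u \<cdot> t = Zero C T B"
  obtains s where "s \<in> Hom C T K" "k \<cdot> s = t"
proof -
  have "Dom C k = K" "Dom C u = A" "Cod C u = B"
    using assms(2,3) by (auto simp: Hom_def)
  then show ?thesis
    using assms(1,4,5) that unfolding is_kernel_def by blast
qed

text \<open>The composite \<open>k \<cdot> x\<close> is annihilated by \<open>u\<close>, so it
  factors uniquely through \<open>k\<close>; both \<open>x\<close> and \<open>y\<close> are such
  factors.\<close>

lemma kernel_is_mono:
  assumes "is_kernel C k u"
  shows "is_mono C k"
proof -
  have "x = y" if "x \<in> Hom C T (Dom C k)" "y \<in> Hom C T (Dom C k)" "k \<cdot> x = k \<cdot> y" for T x y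
  proof -
    have k: "k \<in> Hom C (Dom C k) (Dom C u)" "u \<in> Hom C (Dom C u) (Cod C u)"
      "u \<cdot> k = Zero C (Dom C k) (Cod C u)"
      using kernelD[OF assms] .
    have "u \<cdot> k \<cdot> x = (u \<cdot> k) \<cdot> x"
      using Comp_assoc k that(1) by metis
    also have "\<dots> = Zero C T (Cod C u)"
      using k that Zero_Comp Hom_Obj by metis
    finally have "\<exists>!s. s \<in> Hom C T (Dom C k) \<and> k \<cdot> s = k \<cdot> x"
      using assms k that Comp_Hom unfolding is_kernel_def by blast
    then show ?thesis using that by metis
  qed
  then show ?thesis
    using assms by (auto simp: is_mono_def is_kernel_def)
qed

lemma cokernelI:
  assumes "q \<in> Hom C B Q" "u \<in> Hom C A B" "q \<cdot> u = Zero C A Q"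
    and "\<And>T t. \<lbrakk>t \<in> Hom C B T; t \<cdot> u = Zero C A T\<rbrakk> \<Longrightarrow> \<exists>s\<in>Hom C Q T. s \<cdot> q = t"
    and "\<And>T x y. \<lbrakk>x \<in> Hom C Q T; y \<in> Hom C Q T; x \<cdot> q = y \<cdot> q\<rbrakk> \<Longrightarrow> x = y"
  shows "is_cokernel C q u"
proof -
  have d: "q \<in> Arr C" "u \<in> Arr C" "Dom C q = B" "Cod C q = Q" "Dom C u = A" "Cod C u = B"
    using assms by (auto simp: Hom_def)
  have "\<exists>!s. s \<in> Hom C Q T \<and> s \<cdot> q = t" if "t \<in> Hom C B T" "t \<cdot> u = Zero C A T" for T t
    using assms(4)[OF that] assms(5) by metis
  then show ?thesis
    using d assms(3) by (simp add: is_cokernel_def)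
qed

lemma cokernelD:
  assumes "is_cokernel C q u"
  shows "q \<in> Hom C (Cod C u) (Cod C q)" "u \<in> Hom C (Dom C u) (Cod C u)"
    "q \<cdot> u = Zero C (Dom C u) (Cod C q)"
  using assms by (auto simp: is_cokernel_def Hom_def)

lemma cokernel_factor:
  assumes "is_cokernel C q u" "q \<in> Hom C B Q" "u \<in> Hom C A B" "t \<in> Hom C B T" "t \<cdot> u = Zero C A T"
  obtains s where "s \<in> Hom C Q T" "s \<cdot> q = t"
proof -
  have "Cod C q = Q" "Dom C u = A" "Cod C u = B"
    using assms(2,3) by (auto simp: Hom_def)
  then show ?thesis
    using assms(1,4,5) that unfolding is_cokernel_def by blast
qed

lemma cokernel_is_epi:
  assumes "is_cokernel C q u"
  shows "is_epi C q"
proof -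
  have "x = y" if "x \<in> Hom C (Cod C q) T" "y \<in> Hom C (Cod C q) T" "x \<cdot> q = y \<cdot> q" for T x y
  proof -
    have q: "q \<in> Hom C (Cod C u) (Cod C q)" "u \<in> Hom C (Dom C u) (Cod C u)"
      "q \<cdot> u = Zero C (Dom C u) (Cod C q)"
      using cokernelD[OF assms] .
    have "(x \<cdot> q) \<cdot> u = x \<cdot> q \<cdot> u"
      using Comp_assoc q that(1) by metis
    also have "\<dots> = Zero C (Dom C u) T"
      using q that Comp_Zero Hom_Obj by metis
    finally have "\<exists>!s. s \<in> Hom C (Cod C q) T \<and> s \<cdot> q = x \<cdot> q"
      using assms q that Comp_Hom unfolding is_cokernel_def by blast
    then show ?thesis using that by metis
  qed
  then show ?thesis
    using assms by (auto simp: is_epi_def is_cokernel_def)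
qed

text \<open>Since \<open>v\<close> kills \<open>k\<close>, it factors through \<open>c\<close>.
  Whatever \<open>c\<close> kills is therefore killed by \<open>v\<close> and factors through
  \<open>k\<close>.\<close>

lemma kernel_of_cokernel:
  assumes "is_kernel C k v" "is_cokernel C c k"
  shows "is_kernel C k c"
proof -
  note k = kernelD[OF assms(1)] and c = cokernelD[OF assms(2)]
  have ck: "Cod C k = Dom C v" using k by (simp add: Hom_def)
  obtain w where w: "w \<in> Hom C (Cod C c) (Cod C v)" "w \<cdot> c = v"
    using cokernel_factor[OF assms(2) c(1,2)] k ck by metis
  show ?thesis
  proof (rule kernelI[of k "Dom C k" "Cod C k" c "Cod C c"])
    fix T t
    assume t: "t \<in> Hom C T (Cod C k)" "c \<cdot> t = Zero C T (Cod C c)"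
    have "v \<cdot> t = w \<cdot> c \<cdot> t"
      using Comp_assoc[OF t(1), of c "Cod C c" w "Cod C v"] c(1) w by simp
    also have "\<dots> = Zero C T (Cod C v)"
      using t w Comp_Zero Hom_Obj by metis
    finally show "\<exists>s\<in>Hom C T (Dom C k). k \<cdot> s = t"
      using kernel_lift[OF assms(1) k(1,2)] t ck by metis
  next
    fix T x y
    assume "x \<in> Hom C T (Dom C k)" "y \<in> Hom C T (Dom C k)" "k \<cdot> x = k \<cdot> y"
    then show "x = y"
      using is_monoD[OF kernel_is_mono[OF assms(1)]] k(1) by blast
  qed (use k c ck in auto)
qed

text \<open>Dually, \<open>u\<close> factors through \<open>k\<close>, so whatever kills
  \<open>k\<close> kills \<open>u\<close> and factors through \<open>q\<close>.\<close>

lemma cokernel_of_kernel: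
  assumes "is_cokernel C q u" "is_kernel C k q"
  shows "is_cokernel C q k"
proof -
  note q = cokernelD[OF assms(1)] and k = kernelD[OF assms(2)]
  have cq: "Dom C q = Cod C u" using q by (simp add: Hom_def)
  obtain w where w: "w \<in> Hom C (Dom C u) (Dom C k)" "k \<cdot> w = u"
    using kernel_lift[OF assms(2) k(1,2)] q cq by metis
  show ?thesis
  proof (rule cokernelI[of q "Dom C q" "Cod C q" k "Dom C k"])
    fix T t
    assume t: "t \<in> Hom C (Dom C q) T" "t \<cdot> k = Zero C (Dom C k) T"
    have "t \<cdot> u = (t \<cdot> k) \<cdot> w"
      using Comp_assoc[OF w(1) k(1) t(1)] t(2) w(2) by simp
    also have "\<dots> = Zero C (Dom C u) T"
      using t w Zero_Comp Hom_Obj by metis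
    finally show "\<exists>s\<in>Hom C (Cod C q) T. s \<cdot> q = t"
      using cokernel_factor[OF assms(1) q(1,2)] t cq by metis
  next
    fix T x y
    assume "x \<in> Hom C (Cod C q) T" "y \<in> Hom C (Cod C q) T" "x \<cdot> q = y \<cdot> q"
    then show "x = y"
      using is_epiD[OF cokernel_is_epi[OF assms(1)]] q(1) by blast
  qed (use k q cq in auto)
qed

end

section \<open>Zero objects and biproducts\<close>

context additive_category
begin

lemma zero_object_unique:
  assumes "is_zero_object C Z"
  shows "\<lbrakk>x \<in> Hom C T Z; y \<in> Hom C T Z\<rbrakk> \<Longrightarrow> x = y" "\<lbrakk>x \<in> Hom C Z T; y \<in> Hom C Z T\<rbrakk> \<Longrightarrow> x = y"
  using assms Hom_Obj unfolding is_zero_object_def by blast+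

lemma is_isomorphism_Idm:
  assumes "A \<in> Obj C"
  shows "is_isomorphism C (Idm C A)"
  using isomorphismI[OF Idm_Hom Idm_Hom] Idm_Comp[OF Idm_Hom] assms by blast

lemma mono_comp_eq_Zero:
  assumes "is_mono C f" "f \<in> Hom C A B" "x \<in> Hom C T A" "f \<cdot> x = Zero C T B"
  shows "x = Zero C T A"
proof -
  have "Zero C T A \<in> Hom C T A" "f \<cdot> Zero C T A = Zero C T B"
    using assms Hom_Obj Zero_Hom Comp_Zero by blast+
  then show ?thesis using is_monoD assms by metis
qed

lemma epi_comp_eq_Zero:
  assumes "is_epi C f" "f \<in> Hom C A B" "x \<in> Hom C B T" "x \<cdot> f = Zero C A T"
  shows "x = Zero C B T"
proof -
  have "Zero C B T \<in> Hom C B T" "Zero C B T \<cdot> f = Zero C A T"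
    using assms Hom_Obj Zero_Hom Zero_Comp by blast+
  then show ?thesis using is_epiD assms by metis
qed

text \<open>A monomorphism kills only zero morphisms. Hence its coimage, the cokernel of its kernel,
  may be taken to be the identity.\<close>

lemma mono_kernel_Zero:
  assumes "is_mono C u" "u \<in> Hom C A B" "is_zero_object C Z"
  shows "is_kernel C (Zero C Z A) u" "is_cokernel C (Idm C A) (Zero C Z A)"
proof -
  have o: "A \<in> Obj C" "B \<in> Obj C" "Z \<in> Obj C"
    using assms Hom_Obj by (auto simp: is_zero_object_def)
  note z = Zero_Hom[OF o(3,1)]
  show "is_kernel C (Zero C Z A) u"
  proof (rule kernelI[OF z assms(2) Comp_Zero[OF assms(2) o(3)]])
    fix T t
    assume t: "t \<in> Hom C T A" "u \<cdot> t = Zero C T B"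
    then have T: "T \<in> Obj C" using Hom_Obj by blast
    have "t = Zero C T A"
      using mono_comp_eq_Zero[OF assms(1,2) t] .
    then show "\<exists>s\<in>Hom C T Z. Zero C Z A \<cdot> s = t"
      using Comp_Zero[OF z T] Zero_Hom[OF T o(3)] by blast
  qed (rule zero_object_unique(1)[OF assms(3)])
  show "is_cokernel C (Idm C A) (Zero C Z A)"
  proof (rule cokernelI[OF Idm_Hom[OF o(1)] z Idm_Comp[OF z]])
    fix T t
    assume "t \<in> Hom C A T"
    then show "\<exists>s\<in>Hom C A T. s \<cdot> Idm C A = t"
      using Comp_Idm by blast
  qed (use Comp_Idm in metis)
qed

text \<open>The dual: the image of an epimorphism, the kernel of its cokernel, may be taken to be
  the identity.\<close>

lemma epi_cokernel_Zero:
  assumes "is_epi C u" "u \<in> Hom C A B" "is_zero_object C Z"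
  shows "is_cokernel C (Zero C B Z) u" "is_kernel C (Idm C B) (Zero C B Z)"
proof -
  have o: "A \<in> Obj C" "B \<in> Obj C" "Z \<in> Obj C"
    using assms Hom_Obj by (auto simp: is_zero_object_def)
  note z = Zero_Hom[OF o(2,3)]
  show "is_cokernel C (Zero C B Z) u"
  proof (rule cokernelI[OF z assms(2) Zero_Comp[OF assms(2) o(3)]])
    fix T t
    assume t: "t \<in> Hom C B T" "t \<cdot> u = Zero C A T"
    then have T: "T \<in> Obj C" using Hom_Obj by blast
    have "t = Zero C B T"
      using epi_comp_eq_Zero[OF assms(1,2) t] .
    then show "\<exists>s\<in>Hom C Z T. s \<cdot> Zero C B Z = t"
      using Zero_Comp[OF z T] Zero_Hom[OF o(3) T] by blast
  qed (rule zero_object_unique(2)[OF assms(3)])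
  show "is_kernel C (Idm C B) (Zero C B Z)"
  proof (rule kernelI[OF Idm_Hom[OF o(2)] z Comp_Idm[OF z]])
    fix T t
    assume "t \<in> Hom C T B"
    then show "\<exists>s\<in>Hom C T B. Idm C B \<cdot> s = t"
      using Idm_Comp by blast
  qed (use Idm_Comp in metis)
qed

text \<open>The injections are the morphisms into the product whose components are an identity and a
  zero.\<close>

lemma biproduct_ex:
  assumes "A \<in> Obj C" "B \<in> Obj C"
  obtains P p1 p2 u1 u2 where
    "is_product C A B P p1 p2" "p1 \<in> Hom C P A" "p2 \<in> Hom C P B" "u1 \<in> Hom C A P" "u2 \<in> Hom C B P"
    "p1 \<cdot> u1 = Idm C A" "p2 \<cdot> u1 = Zero C A B" "p1 \<cdot> u2 = Zero C B A" "p2 \<cdot> u2 = Idm C B"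
proof -
  obtain P p1 p2 where P: "is_product C A B P p1 p2"
    using product_ex[OF assms] by blast
  then have p: "p1 \<in> Hom C P A" "p2 \<in> Hom C P B"
    and lift: "\<And>T x y. \<lbrakk>T \<in> Obj C; x \<in> Hom C T A; y \<in> Hom C T B\<rbrakk> \<Longrightarrow>
      \<exists>h. h \<in> Hom C T P \<and> p1 \<cdot> h = x \<and> p2 \<cdot> h = y"
    unfolding is_product_def by blast+
  obtain u1 where "u1 \<in> Hom C A P" "p1 \<cdot> u1 = Idm C A" "p2 \<cdot> u1 = Zero C A B"
    using lift[OF assms(1) Idm_Hom[OF assms(1)] Zero_Hom[OF assms]] by blast
  moreover obtain u2 where "u2 \<in> Hom C B P" "p1 \<cdot> u2 = Zero C B A" "p2 \<cdot> u2 = Idm C B"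
    using lift[OF assms(2) Zero_Hom[OF assms(2,1)] Idm_Hom[OF assms(2)]] by blast
  ultimately show ?thesis using that P p by blast
qed

end

section \<open>Strict morphisms and the existence of pullbacks\<close>

context preabelian_category
begin

text \<open>The coimage of \<open>u\<close> is the identity and its image is \<open>u\<close>
  itself, being the kernel of its own cokernel; the canonical morphism is then an identity.\<close>

lemma kernel_is_strict_mono:
  assumes "is_kernel C u v"
  shows "is_strict_mono C u"
proof -
  define A B where "A = Dom C u" and "B = Cod C u"
  have u: "u \<in> Hom C A B" "is_mono C u"
    using kernelD(1)[OF assms] kernel_is_mono[OF assms] by (auto simp: A_def B_def Hom_def)
  obtain Z where Z: "is_zero_object C Z" using zero_object_ex by blast
  obtain c where c: "is_cokernel C c u" using cokernel_ex u by (auto simp: Hom_def)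
  have "A \<in> Obj C" using u Hom_Obj by blast
  then have I: "Idm C A \<in> Hom C A A" "is_isomorphism C (Idm C A)" "u \<cdot> Idm C A \<cdot> Idm C A = u"
    using Idm_Hom is_isomorphism_Idm Idm_Comp Comp_Idm u by metis+
  then have "Idm C A \<in> Hom C (Cod C (Idm C A)) (Dom C u)"
    by (simp add: A_def Hom_def)
  then have "is_strict C u"
    unfolding is_strict_def
    using mono_kernel_Zero[OF u(2,1) Z] c kernel_of_cokernel[OF assms c] I by blast
  then show ?thesis using u by (simp add: is_strict_mono_def)
qed

text \<open>Dually, the coimage of \<open>u\<close> is \<open>u\<close> itself and its image is the
  identity.\<close>

lemma cokernel_is_strict_epi:
  assumes "is_cokernel C u v"
  shows "is_strict_epi C u"
proof -
  define A B where "A = Dom C u" and "B = Cod C u"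
  have u: "u \<in> Hom C A B" "is_epi C u"
    using cokernelD(1)[OF assms] cokernel_is_epi[OF assms] by (auto simp: A_def B_def Hom_def)
  obtain Z where Z: "is_zero_object C Z" using zero_object_ex by blast
  obtain k where k: "is_kernel C k u" using kernel_ex u by (auto simp: Hom_def)
  have "B \<in> Obj C" using u Hom_Obj by blast
  then have I: "Idm C B \<in> Hom C B B" "is_isomorphism C (Idm C B)" "Idm C B \<cdot> Idm C B \<cdot> u = u"
    using Idm_Hom is_isomorphism_Idm Idm_Comp u by metis+
  then have "Idm C B \<in> Hom C (Cod C u) (Dom C (Idm C B))"
    by (simp add: B_def Hom_def)
  then have "is_strict C u"
    unfolding is_strict_def
    using epi_cokernel_Zero[OF u(2,1) Z] k cokernel_of_kernel[OF assms k] I by blast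
  then show ?thesis using u by (simp add: is_strict_epi_def)
qed

text \<open>The coimage \<open>q\<close> of a monomorphism is invertible, and \<open>w\<close> is
  invertible by strictness, so \<open>u = m \<cdot> w \<cdot> q\<close> agrees up to isomorphism
  with the kernel \<open>m\<close> of its cokernel.\<close>

lemma strict_mono_is_kernel:
  assumes "is_strict_mono C u" "is_cokernel C c u"
  shows "is_kernel C u c"
proof -
  define A B where "A = Dom C u" and "B = Cod C u"
  have mono: "is_mono C u" and u: "u \<in> Hom C A B"
    using assms(1) by (auto simp: is_strict_mono_def is_mono_def A_def B_def Hom_def)
  obtain k q c' m w where kq: "is_kernel C k u" "is_cokernel C q k" "is_cokernel C c' u"
    "is_kernel C m c'" and w: "w \<in> Hom C (Cod C q) (Dom C m)" "m \<cdot> w \<cdot> q = u" "is_isomorphism C w"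
    using assms(1) unfolding is_strict_mono_def is_strict_def by blast
  define L M where "L = Cod C q" and "M = Dom C m"
  have k: "k \<in> Hom C (Dom C k) A" "u \<cdot> k = Zero C (Dom C k) B"
    using kernelD[OF kq(1)] by (auto simp: A_def B_def)
  have q: "q \<in> Hom C A L"
    using cokernelD(1)[OF kq(2)] k by (auto simp: L_def Hom_def)
  have c': "c' \<in> Hom C B (Cod C c')" "c' \<cdot> u = Zero C A (Cod C c')"
    using cokernelD[OF kq(3)] by (auto simp: A_def B_def)
  have c: "c \<in> Hom C B (Cod C c)" "c \<cdot> u = Zero C A (Cod C c)"
    using cokernelD[OF assms(2)] by (auto simp: A_def B_def)
  have m: "m \<in> Hom C M B"
    using kernelD(1)[OF kq(4)] c' by (auto simp: M_def Hom_def)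
  have w1: "w \<in> Hom C L M" using w by (simp add: L_def M_def)
  obtain w' where w': "w' \<in> Hom C M L" "w \<cdot> w' = Idm C M"
    using isomorphismE[OF w(3) w1] by blast
  have A: "A \<in> Obj C" using u Hom_Obj by blast
  have "k = Zero C (Dom C k) A"
    \<comment> \<open>The kernel \<open>k\<close> is zero, so the identity of \<open>A\<close>
      factors through \<open>q\<close>; the resulting \<open>s\<close> will be the inverse of
      \<open>q\<close>.\<close>
    using mono_comp_eq_Zero[OF mono u] k by blast
  then have "Idm C A \<cdot> k = Zero C (Dom C k) A"
    using Idm_Comp k by metis
  then obtain s where s: "s \<in> Hom C L A" "s \<cdot> q = Idm C A"
    using cokernel_factor[OF kq(2) q k(1) Idm_Hom[OF A]] by blast
  have "(q \<cdot> s) \<cdot> q = Idm C L \<cdot> q"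
    using Comp_assoc[OF q s(1) q] s(2) Comp_Idm[OF q] Idm_Comp[OF q] by simp
  then have qs: "q \<cdot> s = Idm C L"
    using is_epiD[OF cokernel_is_epi[OF kq(2)] q] Comp_Hom[OF s(1) q] Idm_Hom Hom_Obj(2)[OF q] by blast
  show ?thesis
  proof (rule kernelI[OF u c])
    fix T t
    assume t: "t \<in> Hom C T B" "c \<cdot> t = Zero C T (Cod C c)"
    \<comment> \<open>Strictness was witnessed by some cokernel \<open>c'\<close>. It factors
      through the given \<open>c\<close>, so \<open>t\<close> is killed by \<open>c'\<close> as
      well.\<close>
    obtain x where x: "x \<in> Hom C (Cod C c) (Cod C c')" "x \<cdot> c = c'"
      using cokernel_factor[OF assms(2) c(1) u c'] by blast
    have "c' \<cdot> t = x \<cdot> c \<cdot> t"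
      using Comp_assoc[OF t(1) c(1) x(1)] x(2) by simp
    also have "\<dots> = Zero C T (Cod C c')"
      using Comp_Zero[OF x(1)] t Hom_Obj(1) by metis
    finally obtain h where h: "h \<in> Hom C T M" "m \<cdot> h = t"
      using kernel_lift[OF kq(4) m c'(1) t(1)] by blast
    have wh: "w' \<cdot> h \<in> Hom C T L" and swh: "s \<cdot> w' \<cdot> h \<in> Hom C T A"
      using Comp_Hom h(1) w'(1) s(1) by blast+
    have "u \<cdot> s \<cdot> w' \<cdot> h = m \<cdot> w \<cdot> q \<cdot> s \<cdot> w' \<cdot> h"
      unfolding w(2)[symmetric] using m w1 q s(1) w'(1) h(1) by (simp add: arr_simps)
    also have "q \<cdot> s \<cdot> w' \<cdot> h = w' \<cdot> h"
      using Comp_assoc[OF wh s(1) q] qs Idm_Comp[OF wh] by simp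
    also have "w \<cdot> w' \<cdot> h = h"
      using Comp_assoc[OF h(1) w'(1) w1] w'(2) Idm_Comp[OF h(1)] by simp
    also have "m \<cdot> h = t" by (fact h(2))
    finally show "\<exists>s\<in>Hom C T A. u \<cdot> s = t"
      using swh by blast
  qed (rule is_monoD[OF mono u])
qed

text \<open>Dually, the image \<open>m\<close> of an epimorphism is invertible, with inverse
  \<open>s\<close>, so \<open>f\<close> agrees up to isomorphism with the cokernel \<open>q\<close>
  of its kernel.\<close>

lemma strict_epi_is_cokernel:
  assumes "is_strict_epi C f" "is_kernel C k f"
  shows "is_cokernel C f k"
proof -
  define A B where "A = Dom C f" and "B = Cod C f"
  have epi: "is_epi C f" and f: "f \<in> Hom C A B"
    using assms(1) by (auto simp: is_strict_epi_def is_epi_def A_def B_def Hom_def)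
  obtain k' q c m w where kq: "is_kernel C k' f" "is_cokernel C q k'" "is_cokernel C c f"
    "is_kernel C m c" and w: "w \<in> Hom C (Cod C q) (Dom C m)" "m \<cdot> w \<cdot> q = f" "is_isomorphism C w"
    using assms(1) unfolding is_strict_epi_def is_strict_def by blast
  define L M where "L = Cod C q" and "M = Dom C m"
  have k': "k' \<in> Hom C (Dom C k') A" "f \<cdot> k' = Zero C (Dom C k') B"
    using kernelD[OF kq(1)] by (auto simp: A_def B_def)
  have k: "k \<in> Hom C (Dom C k) A" "f \<cdot> k = Zero C (Dom C k) B"
    using kernelD[OF assms(2)] by (auto simp: A_def B_def)
  have q: "q \<in> Hom C A L"
    using cokernelD(1)[OF kq(2)] k' by (auto simp: L_def Hom_def)
  have c: "c \<in> Hom C B (Cod C c)" "c \<cdot> f = Zero C A (Cod C c)"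
    using cokernelD[OF kq(3)] by (auto simp: A_def B_def)
  have m: "m \<in> Hom C M B"
    using kernelD(1)[OF kq(4)] c by (auto simp: M_def Hom_def)
  have w1: "w \<in> Hom C L M" using w by (simp add: L_def M_def)
  obtain w' where w': "w' \<in> Hom C M L" "w' \<cdot> w = Idm C L"
    using isomorphismE[OF w(3) w1] by blast
  have B: "B \<in> Obj C" using f Hom_Obj by blast
  have "c = Zero C B (Cod C c)"
    using epi_comp_eq_Zero[OF epi f] c by blast
  then have "c \<cdot> Idm C B = Zero C B (Cod C c)"
    using Comp_Idm c by metis
  then obtain s where s: "s \<in> Hom C B M" "m \<cdot> s = Idm C B"
    using kernel_lift[OF kq(4) m c(1) Idm_Hom[OF B]] by blast
  have "m \<cdot> s \<cdot> m = m \<cdot> Idm C M"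
    using Comp_assoc[OF m s(1) m] s(2) Comp_Idm[OF m] Idm_Comp[OF m] by simp
  then have sm: "s \<cdot> m = Idm C M"
    using is_monoD[OF kernel_is_mono[OF kq(4)] m] Comp_Hom[OF m s(1)] Idm_Hom Hom_Obj(1)[OF m] by blast
  show ?thesis
  proof (rule cokernelI[OF f k])
    fix T t
    assume t: "t \<in> Hom C A T" "t \<cdot> k = Zero C (Dom C k) T"
    obtain x where x: "x \<in> Hom C (Dom C k') (Dom C k)" "k \<cdot> x = k'"
      using kernel_lift[OF assms(2) k(1) f k'] by blast
    have "t \<cdot> k' = (t \<cdot> k) \<cdot> x"
      using Comp_assoc[OF x(1) k(1) t(1)] x(2) by simp
    also have "\<dots> = Zero C (Dom C k') T"
      using Zero_Comp[OF x(1)] t Hom_Obj(2) by metis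
    finally obtain h where h: "h \<in> Hom C L T" "h \<cdot> q = t"
      using cokernel_factor[OF kq(2) q k'(1) t(1)] by blast
    have hw: "h \<cdot> w' \<in> Hom C M T" "w \<cdot> q \<in> Hom C A M" and hws: "(h \<cdot> w') \<cdot> s \<in> Hom C B T"
      using Comp_Hom h(1) w'(1) s(1) w1 q by blast+
    have "((h \<cdot> w') \<cdot> s) \<cdot> f = h \<cdot> w' \<cdot> (s \<cdot> m) \<cdot> w \<cdot> q"
      unfolding w(2)[symmetric] using m w1 q s(1) w'(1) h(1) by (simp add: arr_simps)
    also have "(s \<cdot> m) \<cdot> w \<cdot> q = w \<cdot> q"
      using sm Idm_Comp[OF hw(2)] by simp
    also have "w' \<cdot> w \<cdot> q = q"
      using Comp_assoc[OF q w1 w'(1)] w'(2) Idm_Comp[OF q] by simp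
    also have "h \<cdot> q = t" by (fact h(2))
    finally show "\<exists>s\<in>Hom C B T. s \<cdot> f = t"
      using hws by blast
  qed (rule is_epiD[OF epi f])
qed

text \<open>The pullback is the kernel of \<open>f \<cdot> p \<ominus>\<ominus> g \<cdot> q\<close>
  on the product of \<open>A\<close> and \<open>B\<close>.\<close>

lemma pullback_ex:
  assumes f: "f \<in> Hom C A E" and g: "g \<in> Hom C B E"
  obtains P a b where "is_pullback C f g a b" "a \<in> Hom C P A" "b \<in> Hom C P B"
proof -
  have "A \<in> Obj C" "B \<in> Obj C" using assms Hom_Obj by auto
  then obtain P p q where P: "is_product C A B P p q"
    using product_ex by blast
  then have p: "p \<in> Hom C P A" and q: "q \<in> Hom C P B"
    and lift: "\<And>T x y. \<lbrakk>x \<in> Hom C T A; y \<in> Hom C T B\<rbrakk> \<Longrightarrow>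
      \<exists>!h. h \<in> Hom C T P \<and> p \<cdot> h = x \<and> q \<cdot> h = y"
    using Hom_Obj unfolding is_product_def by blast+
  have fp: "f \<cdot> p \<in> Hom C P E" and gq: "g \<cdot> q \<in> Hom C P E"
    using p q f g Comp_Hom by blast+
  define u where "u = f \<cdot> p \<ominus>\<ominus> g \<cdot> q"
  have u: "u \<in> Hom C P E" using sub_Hom[OF fp gq] by (simp add: u_def)
  then obtain k where k: "is_kernel C k u" using kernel_ex by (auto simp: Hom_def)
  define K where "K = Dom C k"
  have kH: "k \<in> Hom C K P" using kernelD(1)[OF k] u by (simp add: K_def Hom_def)
  have uc: "u \<cdot> t = f \<cdot> p \<cdot> t \<ominus>\<ominus> g \<cdot> q \<cdot> t" if "t \<in> Hom C T P" for T t
    using sub_Comp[OF that fp gq] Comp_assoc[OF that p f] Comp_assoc[OF that q g]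
    by (simp add: u_def)
  have comp: "f \<cdot> p \<cdot> t \<in> Hom C T E" "g \<cdot> q \<cdot> t \<in> Hom C T E" if "t \<in> Hom C T P" for T t
    using that p q f g Comp_Hom by blast+
  have pk: "p \<cdot> k \<in> Hom C K A" "q \<cdot> k \<in> Hom C K B"
    using kH p q Comp_Hom by blast+
  have "u \<cdot> k = Zero C K E"
    using kernelD(3)[OF k] u by (simp add: K_def Hom_def)
  then have eq: "f \<cdot> p \<cdot> k = g \<cdot> q \<cdot> k"
    using sub_eq_Zero comp[OF kH] uc[OF kH] by metis
  have univ: "\<exists>!h. h \<in> Hom C T K \<and> (p \<cdot> k) \<cdot> h = x \<and> (q \<cdot> k) \<cdot> h = y"
    if x: "x \<in> Hom C T A" and y: "y \<in> Hom C T B" and xy: "f \<cdot> x = g \<cdot> y" for T x y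
  proof -
    obtain t where t: "t \<in> Hom C T P" "p \<cdot> t = x" "q \<cdot> t = y"
      using lift[OF x y] by blast
    have "u \<cdot> t = Zero C T E"
      using uc[OF t(1)] t xy sub_self Comp_Hom[OF y g] by metis
    then obtain h where h: "h \<in> Hom C T K" "k \<cdot> h = t"
      using kernel_lift[OF k kH u t(1)] by blast
    show ?thesis
    proof (intro ex1I conjI)
      show "h \<in> Hom C T K" "(p \<cdot> k) \<cdot> h = x" "(q \<cdot> k) \<cdot> h = y"
        using h t Comp_assoc[OF h(1) kH p] Comp_assoc[OF h(1) kH q] by auto
    next
      fix h'
      assume h': "h' \<in> Hom C T K \<and> (p \<cdot> k) \<cdot> h' = x \<and> (q \<cdot> k) \<cdot> h' = y"
      then have kh': "k \<cdot> h' \<in> Hom C T P" using kH Comp_Hom by blast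
      have "p \<cdot> k \<cdot> h' = x" "q \<cdot> k \<cdot> h' = y"
        using h' Comp_assoc[of h' T K k P p A] Comp_assoc[of h' T K k P q B] kH p q by auto
      then have "k \<cdot> h' = k \<cdot> h"
        using lift[OF x y] t h(2) kh' by metis
      then show "h' = h"
        using is_monoD[OF kernel_is_mono[OF k] kH] h' h(1) by blast
    qed
  qed
  have d: "Dom C f = A" "Dom C g = B" "Cod C f = E" "Cod C g = E" "f \<in> Arr C" "g \<in> Arr C"
    "Dom C (p \<cdot> k) = K" "Dom C (q \<cdot> k) = K"
    using f g pk by (auto simp: Hom_def)
  have "is_pullback C f g (p \<cdot> k) (q \<cdot> k)"
    unfolding is_pullback_def d using pk eq univ d by simp
  then show ?thesis using that pk by blast
qed

end

section \<open>Extending a morphism\<close>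

context special_preabelian_category
begin

text \<open>In the application \<open>A\<close>, \<open>E\<close>, \<open>Q\<close> are
  \<open>C(n)\<close>, \<open>C(n+1)\<close>, \<open>C(1)\<close> of one group and
  \<open>A'\<close>, \<open>B\<close>, \<open>K\<close> are the same levels of the other. The maps
  \<open>b\<close> and \<open>d\<close> play there the roles of \<open>i\<close> and
  \<open>c\<close>, so that \<open>p\<close> factors as \<open>i \<cdot> c\<close> on
  \<open>E\<close> and as \<open>b \<cdot> d\<close> on \<open>B\<close>.\<close>

lemma extend_morphism:
  assumes ir: "short_exact C i r" and i: "i \<in> Hom C A E" and r: "r \<in> Hom C E Q"
    and c: "c \<in> Hom C E A" and ic: "i \<cdot> c = nat_mult C p (Idm C E)"
    and ld: "short_exact C l d" and l: "l \<in> Hom C K B" and d: "d \<in> Hom C B A'"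
    and b: "b \<in> Hom C A' B" and b_mono: "is_mono C b" and bd: "b \<cdot> d = nat_mult C p (Idm C B)"
    and f: "f \<in> Hom C A A'"
    and splitting: "\<And>k e. \<lbrakk>short_exact C k e; Dom C k = K; Cod C e = Q; killed_by C p (Cod C k)\<rbrakk>
      \<Longrightarrow> splits C e"
  obtains g where "g \<in> Hom C E B" "g \<cdot> i = b \<cdot> f"
proof -
  have ker_ir: "is_kernel C i r" and coker_ir: "is_cokernel C r i"
    and ker_ld: "is_kernel C l d" and coker_ld: "is_cokernel C d l"
    using ir ld by (auto simp: short_exact_def)
  have o: "A \<in> Obj C" "E \<in> Obj C" "Q \<in> Obj C" "K \<in> Obj C" "B \<in> Obj C" "A' \<in> Obj C"
    using i r l b Hom_Obj by blast+
  have i_mono: "is_mono C i" and r_epi: "is_epi C r"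
    using ker_ir coker_ir kernel_is_mono cokernel_is_epi by auto
  have ri: "r \<cdot> i = Zero C A Q"
    using kernelD(3)[OF ker_ir] i r by (simp add: Hom_def)
  have dl: "d \<cdot> l = Zero C K A'"
    using kernelD(3)[OF ker_ld] l d by (simp add: Hom_def)
  \<comment> \<open>Cancelling the monomorphisms \<open>i\<close> and \<open>b\<close> shows that
    the factors of \<open>p\<close> also compose to \<open>p\<close> in the opposite order.\<close>
  have ci: "c \<cdot> i = nat_mult C p (Idm C A)"
  proof (rule is_monoD[OF i_mono i Comp_Hom[OF i c] nat_mult_Hom[OF Idm_Hom[OF o(1)]]])
    show "i \<cdot> c \<cdot> i = i \<cdot> nat_mult C p (Idm C A)"
      using Comp_assoc[OF i c i] ic nat_mult_Idm_commute[OF i] by simp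
  qed
  have db: "d \<cdot> b = nat_mult C p (Idm C A')"
  proof (rule is_monoD[OF b_mono b Comp_Hom[OF b d] nat_mult_Hom[OF Idm_Hom[OF o(6)]]])
    show "b \<cdot> d \<cdot> b = b \<cdot> nat_mult C p (Idm C A')"
      using Comp_assoc[OF b d b] bd nat_mult_Idm_commute[OF b] by simp
  qed
  have fc: "f \<cdot> c \<in> Hom C E A'" and bf: "b \<cdot> f \<in> Hom C A B"
    using f c b Comp_Hom by blast+
  \<comment> \<open>In terms of generalized elements, \<open>G\<close> consists of the pairs of
    \<open>y\<close> in \<open>B\<close> and \<open>x\<close> in \<open>E\<close> with
    \<open>d y = f c x\<close>; its projections are \<open>\<beta>\<close> and
    \<open>\<pi>\<close>.\<close>
  obtain G \<beta> \<pi> where pb: "is_pullback C d (f \<cdot> c) \<beta> \<pi>" and \<beta>: "\<beta> \<in> Hom C G B" and \<pi>: "\<pi> \<in> Hom C G E"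
    using pullback_ex[OF d fc] by blast
  have sq: "d \<cdot> \<beta> = f \<cdot> c \<cdot> \<pi>"
    using pb Comp_assoc[OF \<pi> c f] by (simp add: is_pullback_def)
  \<comment> \<open>Axiom (A2) enters here: \<open>d\<close> is a cokernel, hence a strict
    epimorphism, and \<open>\<pi>\<close> is its base change.\<close>
  have "is_strict_epi C \<pi>"
    using pullback_strict_epi[OF cokernel_is_strict_epi[OF coker_ld] pb] .
  have Go: "G \<in> Obj C" using \<pi> Hom_Obj by blast

  \<comment> \<open>The kernel of \<open>\<pi>\<close> is the copy of \<open>K\<close> in
    \<open>G\<close> with components \<open>l\<close> and zero.\<close>
  have "d \<cdot> l = (f \<cdot> c) \<cdot> Zero C K E"
    using dl Comp_Zero[OF fc o(4)] by simp
  then obtain \<kappa> where \<kappa>: "\<kappa> \<in> Hom C K G" "\<beta> \<cdot> \<kappa> = l" "\<pi> \<cdot> \<kappa> = Zero C K E"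
    using pullback_lift[OF pb \<beta> \<pi> l Zero_Hom[OF o(4,2)]] by blast
  have ker_\<kappa>: "is_kernel C \<kappa> \<pi>"
  proof (rule kernelI[OF \<kappa>(1) \<pi> \<kappa>(3)])
    fix T t
    assume t: "t \<in> Hom C T G" "\<pi> \<cdot> t = Zero C T E"
    then have T: "T \<in> Obj C" using Hom_Obj by blast
    have "d \<cdot> \<beta> \<cdot> t = (f \<cdot> c) \<cdot> \<pi> \<cdot> t"
      using Comp_assoc[OF t(1) \<beta> d] Comp_assoc[OF t(1) \<pi> fc] Comp_assoc[OF \<pi> c f] sq by simp
    also have "\<dots> = Zero C T A'"
      using t(2) Comp_Zero[OF fc T] by simp
    finally obtain s where s: "s \<in> Hom C T K" "l \<cdot> s = \<beta> \<cdot> t"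
      using kernel_lift[OF ker_ld l d Comp_Hom[OF t(1) \<beta>]] by blast
    have "\<kappa> \<cdot> s = t"
    proof (rule pullback_cancel[OF pb \<beta> \<pi> Comp_Hom[OF s(1) \<kappa>(1)] t(1)])
      show "\<beta> \<cdot> \<kappa> \<cdot> s = \<beta> \<cdot> t"
        using Comp_assoc[OF s(1) \<kappa>(1) \<beta>] \<kappa>(2) s(2) by simp
      show "\<pi> \<cdot> \<kappa> \<cdot> s = \<pi> \<cdot> t"
        using Comp_assoc[OF s(1) \<kappa>(1) \<pi>] \<kappa>(3) Zero_Comp[OF s(1) o(2)] t(2) by simp
    qed
    then show "\<exists>s\<in>Hom C T K. \<kappa> \<cdot> s = t" using s by blast
  next
    fix T x y
    assume xy: "x \<in> Hom C T K" "y \<in> Hom C T K" "\<kappa> \<cdot> x = \<kappa> \<cdot> y"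
    then have "l \<cdot> x = l \<cdot> y"
      using Comp_assoc[OF xy(1) \<kappa>(1) \<beta>] Comp_assoc[OF xy(2) \<kappa>(1) \<beta>] \<kappa>(2) by simp
    then show "x = y"
      using is_monoD[OF kernel_is_mono[OF ker_ld] l] xy by blast
  qed
  have coker_\<pi>: "is_cokernel C \<pi> \<kappa>"
    using strict_epi_is_cokernel[OF \<open>is_strict_epi C \<pi>\<close> ker_\<kappa>] .

  \<comment> \<open>The pair \<open>b \<cdot> f\<close>, \<open>i\<close> is compatible because both
    of its images in \<open>A'\<close> are \<open>p\<close> times \<open>f\<close>; it defines
    \<open>\<sigma>\<close>.\<close>
  have "d \<cdot> b \<cdot> f = nat_mult C p (Idm C A') \<cdot> f"
    using Comp_assoc[OF f b d] db by simp
  also have "\<dots> = (f \<cdot> c) \<cdot> i"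
    using Comp_assoc[OF i c f] ci nat_mult_Idm_commute[OF f] by simp
  finally obtain \<sigma> where \<sigma>: "\<sigma> \<in> Hom C A G" "\<beta> \<cdot> \<sigma> = b \<cdot> f" "\<pi> \<cdot> \<sigma> = i"
    using pullback_lift[OF pb \<beta> \<pi> bf i] by blast

  \<comment> \<open>This is checked on the two components, using \<open>p = b \<cdot> d\<close> on
    \<open>B\<close> and \<open>p = i \<cdot> c\<close> on \<open>E\<close>.\<close>
  have p_G: "nat_mult C p (Idm C G) = \<sigma> \<cdot> c \<cdot> \<pi>"
  proof (rule pullback_cancel[OF pb \<beta> \<pi> nat_mult_Hom[OF Idm_Hom[OF Go]]
        Comp_Hom[OF Comp_Hom[OF \<pi> c] \<sigma>(1)]])
    have "\<beta> \<cdot> nat_mult C p (Idm C G) = (b \<cdot> d) \<cdot> \<beta>"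
      using nat_mult_Idm_commute[OF \<beta>] bd by simp
    also have "\<dots> = b \<cdot> f \<cdot> c \<cdot> \<pi>"
      using Comp_assoc[OF \<beta> d b] sq by simp
    also have "\<dots> = (b \<cdot> f) \<cdot> c \<cdot> \<pi>"
      using Comp_assoc[OF Comp_Hom[OF \<pi> c] f b] by simp
    also have "\<dots> = \<beta> \<cdot> \<sigma> \<cdot> c \<cdot> \<pi>"
      using Comp_assoc[OF Comp_Hom[OF \<pi> c] \<sigma>(1) \<beta>] \<sigma>(2) by simp
    finally show "\<beta> \<cdot> nat_mult C p (Idm C G) = \<beta> \<cdot> \<sigma> \<cdot> c \<cdot> \<pi>" .
    show "\<pi> \<cdot> nat_mult C p (Idm C G) = \<pi> \<cdot> \<sigma> \<cdot> c \<cdot> \<pi>"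
      using nat_mult_Idm_commute[OF \<pi>] ic Comp_assoc[OF \<pi> c i] \<sigma>(3)
        Comp_assoc[OF Comp_Hom[OF \<pi> c] \<sigma>(1) \<pi>] by simp
  qed

  obtain q where coker_q: "is_cokernel C q \<sigma>"
    using cokernel_ex \<sigma>(1) by (auto simp: Hom_def)
  define H where "H = Cod C q"
  have q: "q \<in> Hom C G H" and q\<sigma>: "q \<cdot> \<sigma> = Zero C A H"
    using cokernelD[OF coker_q] \<sigma>(1) by (auto simp: H_def Hom_def)
  have q_epi: "is_epi C q" by (rule cokernel_is_epi[OF coker_q])
  have Ho: "H \<in> Obj C" using q Hom_Obj by blast
  have r\<pi>: "r \<cdot> \<pi> \<in> Hom C G Q" by (rule Comp_Hom[OF \<pi> r])
  have "(r \<cdot> \<pi>) \<cdot> \<sigma> = Zero C A Q"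
    using Comp_assoc[OF \<sigma>(1) \<pi> r] \<sigma>(3) ri by simp
  then obtain e where e: "e \<in> Hom C H Q" "e \<cdot> q = r \<cdot> \<pi>"
    using cokernel_factor[OF coker_q q \<sigma>(1) r\<pi>] by blast
  define k where "k = q \<cdot> \<kappa>"
  have k: "k \<in> Hom C K H" unfolding k_def by (rule Comp_Hom[OF \<kappa>(1) q])

  \<comment> \<open>A morphism on \<open>H\<close> that kills \<open>k\<close>, composed with
    \<open>q\<close>, descends along \<open>\<pi>\<close> to \<open>E\<close>. There it kills
    \<open>i\<close>, since \<open>q\<close> kills \<open>\<sigma>\<close>, so it descends further
    along \<open>r\<close> to \<open>Q\<close>.\<close>
  have coker_e: "is_cokernel C e k"
  proof (rule cokernelI[OF e(1) k])
    show "e \<cdot> k = Zero C K Q"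
      using Comp_assoc[OF \<kappa>(1) q e(1)] e(2) Comp_assoc[OF \<kappa>(1) \<pi> r] \<kappa>(3) Comp_Zero[OF r o(4)]
      by (simp add: k_def)
  next
    fix T t
    assume t: "t \<in> Hom C H T" "t \<cdot> k = Zero C K T"
    have tq: "t \<cdot> q \<in> Hom C G T" by (rule Comp_Hom[OF q t(1)])
    have "(t \<cdot> q) \<cdot> \<kappa> = Zero C K T"
      using Comp_assoc[OF \<kappa>(1) q t(1)] t(2) by (simp add: k_def)
    then obtain s where s: "s \<in> Hom C E T" "s \<cdot> \<pi> = t \<cdot> q"
      using cokernel_factor[OF coker_\<pi> \<pi> \<kappa>(1) tq] by blast
    have "s \<cdot> i = (s \<cdot> \<pi>) \<cdot> \<sigma>"
      using Comp_assoc[OF \<sigma>(1) \<pi> s(1)] \<sigma>(3) by simp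
    also have "\<dots> = Zero C A T"
      using Comp_assoc[OF \<sigma>(1) q t(1)] s(2) q\<sigma> Comp_Zero[OF t(1) o(1)] by simp
    finally obtain s' where s': "s' \<in> Hom C Q T" "s' \<cdot> r = s"
      using cokernel_factor[OF coker_ir r i s(1)] by blast
    have "(s' \<cdot> e) \<cdot> q = t \<cdot> q"
      using Comp_assoc[OF q e(1) s'(1)] e(2) Comp_assoc[OF \<pi> r s'(1)] s'(2) s(2) by simp
    then have "s' \<cdot> e = t"
      using is_epiD[OF q_epi q Comp_Hom[OF e(1) s'(1)] t(1)] by blast
    then show "\<exists>s\<in>Hom C Q T. s \<cdot> e = t" using s' by blast
  next
    fix T x y
    assume xy: "x \<in> Hom C Q T" "y \<in> Hom C Q T" "x \<cdot> e = y \<cdot> e"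
    have "(x \<cdot> r) \<cdot> \<pi> = (y \<cdot> r) \<cdot> \<pi>"
      using Comp_assoc[OF \<pi> r xy(1)] Comp_assoc[OF \<pi> r xy(2)] Comp_assoc[OF q e(1) xy(1)]
        Comp_assoc[OF q e(1) xy(2)] e(2) xy(3) by simp
    then have "x \<cdot> r = y \<cdot> r"
      using is_epiD[OF cokernel_is_epi[OF coker_\<pi>] \<pi>] Comp_Hom[OF r] xy by blast
    then show "x = y"
      using is_epiD[OF r_epi r] xy by blast
  qed

  \<comment> \<open>\<open>k\<close> is the pushout of the kernel \<open>(\<kappa>, \<sigma>) : K \<oplus> A \<rightarrow> G\<close> of \<open>r \<pi>\<close> along the projection to \<open>K\<close>.\<close>
  have "is_strict_mono C k"
  proof -
    obtain P p1 p2 u1 u2 where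
      P: "is_product C K A P p1 p2" and p: "p1 \<in> Hom C P K" "p2 \<in> Hom C P A"
      and u: "u1 \<in> Hom C K P" "u2 \<in> Hom C A P"
      and pu: "p1 \<cdot> u1 = Idm C K" "p2 \<cdot> u1 = Zero C K A" "p1 \<cdot> u2 = Zero C A K" "p2 \<cdot> u2 = Idm C A"
      using biproduct_ex[OF o(4,1)] by blast
    have Po: "P \<in> Obj C" using p Hom_Obj by blast
    have \<kappa>p: "\<kappa> \<cdot> p1 \<in> Hom C P G" and \<sigma>p: "\<sigma> \<cdot> p2 \<in> Hom C P G"
      using \<kappa>(1) \<sigma>(1) p Comp_Hom by blast+
    define m where "m = Add C (\<kappa> \<cdot> p1) (\<sigma> \<cdot> p2)"
    have m: "m \<in> Hom C P G" unfolding m_def by (rule Add_Hom[OF \<kappa>p \<sigma>p])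
    have mc: "m \<cdot> t = Add C (\<kappa> \<cdot> p1 \<cdot> t) (\<sigma> \<cdot> p2 \<cdot> t)" if "t \<in> Hom C T P" for T t
      using Add_Comp[OF that \<kappa>p \<sigma>p] Comp_assoc[OF that p(1) \<kappa>(1)] Comp_assoc[OF that p(2) \<sigma>(1)]
      by (simp add: m_def)
    have mu: "m \<cdot> u1 = \<kappa>" "m \<cdot> u2 = \<sigma>"
      using mc[OF u(1)] mc[OF u(2)] pu Comp_Idm[OF \<kappa>(1)] Comp_Idm[OF \<sigma>(1)] Comp_Zero[OF \<kappa>(1) o(1)]
        Comp_Zero[OF \<sigma>(1) o(4)] Add_Zero[OF \<kappa>(1) \<kappa>(1)] Zero_Add[OF \<sigma>(1) \<sigma>(1)] by simp_all
    have \<pi>m: "\<pi> \<cdot> m = i \<cdot> p2"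
      using Comp_Add[OF \<kappa>p \<sigma>p \<pi>] Comp_assoc[OF p(1) \<kappa>(1) \<pi>] Comp_assoc[OF p(2) \<sigma>(1) \<pi>] \<kappa>(3) \<sigma>(3)
        Zero_Comp[OF p(1) o(2)] Zero_Add[OF Comp_Hom[OF p(2) i] Comp_Hom[OF p(2) i]]
      by (simp add: m_def)
    have "is_kernel C m (r \<cdot> \<pi>)"
    proof (rule kernelI[OF m r\<pi>])
      show "(r \<cdot> \<pi>) \<cdot> m = Zero C P Q"
        using Comp_assoc[OF m \<pi> r] \<pi>m Comp_assoc[OF p(2) i r] ri Zero_Comp[OF p(2) o(3)] by simp
    next
      fix T t
      assume t: "t \<in> Hom C T G" "(r \<cdot> \<pi>) \<cdot> t = Zero C T Q"
      have To: "T \<in> Obj C" using t Hom_Obj by blast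
      have \<pi>t: "\<pi> \<cdot> t \<in> Hom C T E" by (rule Comp_Hom[OF t(1) \<pi>])
      have "r \<cdot> \<pi> \<cdot> t = Zero C T Q"
        using t(2) Comp_assoc[OF t(1) \<pi> r] by simp
      then obtain y where y: "y \<in> Hom C T A" "i \<cdot> y = \<pi> \<cdot> t"
        using kernel_lift[OF ker_ir i r \<pi>t] by blast
      have \<sigma>y: "\<sigma> \<cdot> y \<in> Hom C T G" by (rule Comp_Hom[OF y(1) \<sigma>(1)])
      \<comment> \<open>Subtracting \<open>\<sigma> \<cdot> y\<close> removes the component of
        \<open>t\<close> in \<open>E\<close>, so the rest comes from \<open>K\<close>; the two parts
        together give the lift to the biproduct.\<close>
      have "\<pi> \<cdot> (t \<ominus>\<ominus> \<sigma> \<cdot> y) = Zero C T E"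
        using Comp_sub[OF t(1) \<sigma>y \<pi>] Comp_assoc[OF y(1) \<sigma>(1) \<pi>] \<sigma>(3) y(2) sub_self[OF \<pi>t \<pi>t] by simp
      then obtain x where x: "x \<in> Hom C T K" "\<kappa> \<cdot> x = t \<ominus>\<ominus> \<sigma> \<cdot> y"
        using kernel_lift[OF ker_\<kappa> \<kappa>(1) \<pi> sub_Hom[OF t(1) \<sigma>y]] by blast
      obtain s where s: "s \<in> Hom C T P" "p1 \<cdot> s = x" "p2 \<cdot> s = y"
        using P To x(1) y(1) unfolding is_product_def by blast
      have "m \<cdot> s = t"
        using mc[OF s(1)] s x sub_Add_cancel[OF t(1) \<sigma>y] by simp
      then show "\<exists>s\<in>Hom C T P. m \<cdot> s = t" using s by blast
    next
      fix T x y
      assume xy: "x \<in> Hom C T P" "y \<in> Hom C T P" "m \<cdot> x = m \<cdot> y"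
      have To: "T \<in> Obj C" using xy Hom_Obj by blast
      have px: "p1 \<cdot> x \<in> Hom C T K" "p2 \<cdot> x \<in> Hom C T A" "p1 \<cdot> y \<in> Hom C T K" "p2 \<cdot> y \<in> Hom C T A"
        using p xy Comp_Hom by blast+
      have "i \<cdot> p2 \<cdot> x = i \<cdot> p2 \<cdot> y"
        using Comp_assoc[OF xy(1) m \<pi>] Comp_assoc[OF xy(2) m \<pi>] \<pi>m Comp_assoc[OF xy(1) p(2) i]
          Comp_assoc[OF xy(2) p(2) i] xy(3) by simp
      then have 2: "p2 \<cdot> x = p2 \<cdot> y"
        using is_monoD[OF i_mono i] px by blast
      then have "\<kappa> \<cdot> p1 \<cdot> x = \<kappa> \<cdot> p1 \<cdot> y"
        using Add_right_cancel[OF Comp_Hom[OF px(1) \<kappa>(1)] Comp_Hom[OF px(3) \<kappa>(1)]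
            Comp_Hom[OF px(4) \<sigma>(1)]] mc[OF xy(1)] mc[OF xy(2)] xy(3) by simp
      then have 1: "p1 \<cdot> x = p1 \<cdot> y"
        using is_monoD[OF kernel_is_mono[OF ker_\<kappa>] \<kappa>(1)] px by blast
      have "\<exists>!h. h \<in> Hom C T P \<and> p1 \<cdot> h = p1 \<cdot> y \<and> p2 \<cdot> h = p2 \<cdot> y"
        using P To px unfolding is_product_def by blast
      then show "x = y" using 1 2 xy by metis
    qed
    then have strict: "is_strict_mono C m" by (rule kernel_is_strict_mono)
    have qm: "q \<cdot> m = k \<cdot> p1"
      using Comp_Add[OF \<kappa>p \<sigma>p q] Comp_assoc[OF p(1) \<kappa>(1) q] Comp_assoc[OF p(2) \<sigma>(1) q] q\<sigma>
        Zero_Comp[OF p(2) Ho] Add_Zero[OF Comp_Hom[OF p(1) k] Comp_Hom[OF p(1) k]]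
      by (simp add: m_def k_def)
    have univ: "\<exists>!h. h \<in> Hom C H T \<and> h \<cdot> q = x \<and> h \<cdot> k = y"
      if x: "x \<in> Hom C G T" and y: "y \<in> Hom C K T" and xy: "x \<cdot> m = y \<cdot> p1" for T x y
    proof -
      \<comment> \<open>Restricting \<open>x \<cdot> m = y \<cdot> p1\<close> along
        \<open>u2\<close> shows that \<open>x\<close> kills \<open>\<sigma>\<close> and so factors
        through \<open>q\<close>; restricting along \<open>u1\<close> identifies the other leg with
        \<open>y\<close>.\<close>
      have "x \<cdot> \<sigma> = (y \<cdot> p1) \<cdot> u2"
        using Comp_assoc[OF u(2) m x] mu(2) xy by simp
      also have "\<dots> = Zero C A T"
        using Comp_assoc[OF u(2) p(1) y] pu(3) Comp_Zero[OF y o(1)] by simp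
      finally obtain h where h: "h \<in> Hom C H T" "h \<cdot> q = x"
        using cokernel_factor[OF coker_q q \<sigma>(1) x] by blast
      have "h \<cdot> k = (x \<cdot> m) \<cdot> u1"
        using Comp_assoc[OF \<kappa>(1) q h(1)] h(2) Comp_assoc[OF u(1) m x] mu(1) by (simp add: k_def)
      also have "\<dots> = y"
        using xy Comp_assoc[OF u(1) p(1) y] pu(1) Comp_Idm[OF y] by simp
      finally show ?thesis
        using h is_epiD[OF q_epi q] by blast
    qed
    have dc: "Cod C m = G" "Cod C p1 = K" "Cod C q = H" "Cod C k = H" "m \<in> Arr C" "p1 \<in> Arr C"
      "Dom C m = P" "Dom C p1 = P"
      using m p q k by (auto simp: Hom_def)
    have "is_pushout C m p1 q k"
      unfolding is_pushout_def dc using q k qm univ dc(5,6) by simp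
    \<comment> \<open>Axiom (A1) enters here.\<close>
    then show ?thesis by (rule pushout_strict_mono[OF strict])
  qed
  then have ex: "short_exact C k e"
    using coker_e strict_mono_is_kernel by (simp add: short_exact_def)

  \<comment> \<open>On \<open>G\<close>, multiplication by \<open>p\<close> factors through
    \<open>\<sigma>\<close>, which \<open>q\<close> kills; as \<open>q\<close> is an epimorphism,
    \<open>p\<close> vanishes on \<open>H\<close>.\<close>
  have "nat_mult C p (Idm C H) \<cdot> q = (q \<cdot> \<sigma>) \<cdot> c \<cdot> \<pi>"
    using nat_mult_Idm_commute[OF q, of p] p_G Comp_assoc[OF Comp_Hom[OF \<pi> c] \<sigma>(1) q] by simp
  also have "\<dots> = Zero C G H"
    using q\<sigma> Zero_Comp[OF Comp_Hom[OF \<pi> c] Ho] by simp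
  finally have "killed_by C p H"
    using epi_comp_eq_Zero[OF q_epi q nat_mult_Hom[OF Idm_Hom[OF Ho]]] by (simp add: killed_by_def)
  then have "splits C e"
    using splitting[OF ex] k e(1) by (simp add: Hom_def)
  then obtain s where s: "s \<in> Hom C Q H" "e \<cdot> s = Idm C Q"
    using e(1) by (auto simp: splits_def Hom_def)
  have I: "Idm C H \<in> Hom C H H" "Idm C G \<in> Hom C G G" using Ho Go Idm_Hom by auto
  have se: "s \<cdot> e \<in> Hom C H H" by (rule Comp_Hom[OF e(1) s(1)])
  \<comment> \<open>The section \<open>s\<close> of \<open>e\<close> is turned into a retraction
    \<open>\<rho>\<close> of \<open>k\<close>: the identity minus \<open>s \<cdot> e\<close> is
    killed by \<open>e\<close> and factors through \<open>k\<close>.\<close>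
  have "e \<cdot> (Idm C H \<ominus>\<ominus> s \<cdot> e) = Zero C H Q"
    using Comp_sub[OF I(1) se e(1)] Comp_assoc[OF e(1) s(1) e(1)] s(2) Idm_Comp[OF e(1)]
      Comp_Idm[OF e(1)] sub_self[OF e(1) e(1)] by simp
  then obtain \<rho> where \<rho>: "\<rho> \<in> Hom C H K" "k \<cdot> \<rho> = Idm C H \<ominus>\<ominus> s \<cdot> e"
    using kernel_lift[of k e K H Q] ex k e(1) sub_Hom[OF I(1) se] unfolding short_exact_def by blast
  have ek: "e \<cdot> k = Zero C K Q"
    using cokernelD(3)[OF coker_e] k e(1) by (simp add: Hom_def)
  have "k \<cdot> \<rho> \<cdot> k = k \<cdot> Idm C K"
    using Comp_assoc[OF k \<rho>(1) k] \<rho>(2) sub_Comp[OF k I(1) se] Idm_Comp[OF k] Comp_Idm[OF k]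
      Comp_assoc[OF k e(1) s(1)] ek Comp_Zero[OF s(1) o(4)] sub_Zero[OF k] by simp
  then have \<rho>k: "\<rho> \<cdot> k = Idm C K"
    using is_monoD[OF kernel_is_mono k Comp_Hom[OF k \<rho>(1)] Idm_Hom[OF o(4)]] ex
    unfolding short_exact_def by blast
  \<comment> \<open>On \<open>G\<close> this is a retraction of \<open>\<kappa>\<close> that
    vanishes on \<open>\<sigma>\<close>.\<close>
  define R where "R = \<rho> \<cdot> q"
  have R: "R \<in> Hom C G K" unfolding R_def by (rule Comp_Hom[OF q \<rho>(1)])
  have R\<kappa>: "R \<cdot> \<kappa> = Idm C K"
    using Comp_assoc[OF \<kappa>(1) q \<rho>(1)] \<rho>k by (simp add: R_def k_def)
  have R\<sigma>: "R \<cdot> \<sigma> = Zero C A K"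
    using Comp_assoc[OF \<sigma>(1) q \<rho>(1)] q\<sigma> Comp_Zero[OF \<rho>(1) o(1)] by (simp add: R_def)
  have \<kappa>R: "\<kappa> \<cdot> R \<in> Hom C G G" by (rule Comp_Hom[OF R \<kappa>(1)])
  \<comment> \<open>\<open>N\<close> kills \<open>\<kappa>\<close>, so it descends along
    \<open>\<pi>\<close> to \<open>\<tau>\<close>. It fixes \<open>\<sigma>\<close>, whence
    \<open>\<tau> \<cdot> i = \<sigma>\<close>, and the component of \<open>\<tau>\<close> in
    \<open>B\<close> is the desired extension.\<close>
  define N where "N = Idm C G \<ominus>\<ominus> \<kappa> \<cdot> R"
  have N: "N \<in> Hom C G G" unfolding N_def by (rule sub_Hom[OF I(2) \<kappa>R])
  have "N \<cdot> \<kappa> = Zero C K G"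
    using sub_Comp[OF \<kappa>(1) I(2) \<kappa>R] Comp_assoc[OF \<kappa>(1) R \<kappa>(1)] R\<kappa> Idm_Comp[OF \<kappa>(1)]
      Comp_Idm[OF \<kappa>(1)] sub_self[OF \<kappa>(1) \<kappa>(1)] by (simp add: N_def)
  then obtain \<tau> where \<tau>: "\<tau> \<in> Hom C E G" "\<tau> \<cdot> \<pi> = N"
    using cokernel_factor[OF coker_\<pi> \<pi> \<kappa>(1) N] by blast
  have N\<sigma>: "N \<cdot> \<sigma> = \<sigma>"
    using sub_Comp[OF \<sigma>(1) I(2) \<kappa>R] Comp_assoc[OF \<sigma>(1) R \<kappa>(1)] R\<sigma> Idm_Comp[OF \<sigma>(1)]
      Comp_Zero[OF \<kappa>(1) o(1)] sub_Zero[OF \<sigma>(1)] by (simp add: N_def)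
  have \<tau>i: "\<tau> \<cdot> i = \<sigma>"
    using Comp_assoc[OF \<sigma>(1) \<pi> \<tau>(1)] \<tau>(2) \<sigma>(3) N\<sigma> by simp
  show ?thesis
  proof
    show "\<beta> \<cdot> \<tau> \<in> Hom C E B" by (rule Comp_Hom[OF \<tau>(1) \<beta>])
    show "(\<beta> \<cdot> \<tau>) \<cdot> i = b \<cdot> f"
      using Comp_assoc[OF i \<tau>(1) \<beta>] \<tau>i \<sigma>(2) by simp
  qed
qed

end

section \<open>Splitting of extensions in full subcategories\<close>

lemma full_subcategory_sel [simp]:
  "Dom (full_subcategory C V) = Dom C" "Cod (full_subcategory C V) = Cod C"
  "Idm (full_subcategory C V) = Idm C" "Comp (full_subcategory C V) = Comp C"
  "Zero (full_subcategory C V) = Zero C" "Obj (full_subcategory C V) = Obj C \<inter> V"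
  "f \<in> Arr (full_subcategory C V) \<longleftrightarrow> f \<in> Arr C \<and> Dom C f \<in> V \<and> Cod C f \<in> V"
  by (simp_all add: full_subcategory_def)

lemma Hom_full_subcategory:
  "f \<in> Hom (full_subcategory C V) A B \<longleftrightarrow> f \<in> Hom C A B \<and> A \<in> V \<and> B \<in> V"
  by (auto simp: Hom_def)

text \<open>Composition, zeros and the morphisms between objects of \<open>V\<close> are unchanged,
  and the universal properties are only tested on fewer objects.\<close>

lemma short_exact_full_subcategory:
  assumes "short_exact C k e" "Dom C k \<in> V" "Cod C k \<in> V" "Cod C e \<in> V"
  shows "short_exact (full_subcategory C V) k e"
proof -
  have ker: "is_kernel C k e" and coker: "is_cokernel C e k"
    using assms(1) by (simp_all add: short_exact_def)
  have "Cod C k = Dom C e"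
    using ker by (simp add: is_kernel_def)
  then have "Dom C e \<in> V" using assms(3) by simp
  then have "is_kernel (full_subcategory C V) k e"
    using ker assms(2-4) unfolding is_kernel_def by (simp add: Hom_full_subcategory)
  moreover have "is_cokernel (full_subcategory C V) e k"
    using coker assms(2-4) \<open>Dom C e \<in> V\<close> unfolding is_cokernel_def
    by (simp add: Hom_full_subcategory)
  ultimately show ?thesis by (simp add: short_exact_def)
qed

context category
begin

text \<open>The identity of the middle object makes the sequence a member of its own class, to which
  the vanishing of \<open>Ext\<close> applies; a section in the subcategory is one in
  \<open>C\<close>.\<close>

lemma extension_splits:
  assumes "Ext_eq_zero (full_subcategory C V) A2 A1"
    and "short_exact C k e" "Dom C k = A1" "Cod C e = A2" "A1 \<in> V" "Cod C k \<in> V" "A2 \<in> V"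
  shows "splits C e"
proof -
  let ?V = "full_subcategory C V"
  have "k \<in> Arr C" "e \<in> Arr C" "Cod C k = Dom C e"
    using assms(2) by (simp_all add: short_exact_def is_kernel_def)
  then have H: "Cod C k = Dom C e" "Cod C k \<in> Obj C" "k \<in> Hom C A1 (Cod C k)"
      "e \<in> Hom C (Cod C k) A2"
    using assms(3,4) Cod_Obj[of k] by (simp_all add: Hom_def)
  have I: "Idm C (Cod C k) \<in> Hom C (Cod C k) (Cod C k)"
    using Idm_Hom H by blast
  have "(k, e) \<in> extensions ?V A2 A1"
    using short_exact_full_subcategory[OF assms(2), of V] assms(3-7) by (simp add: extensions_def)
  moreover have "is_isomorphism ?V (Idm C (Cod C k))"
    unfolding is_isomorphism_def
    by (intro conjI bexI[of _ "Idm C (Cod C k)"])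
      (use Idm_Arr[OF H(2)] Idm_Comp[OF I] I assms(6) in \<open>simp_all add: Hom_full_subcategory\<close>)
  moreover have "Idm C (Cod C k) \<in> Hom ?V (Cod ?V k) (Cod ?V k)"
    using I assms(6) by (simp add: Hom_full_subcategory)
  moreover have "Idm C (Cod C k) \<cdot> k = k" "e \<cdot> Idm C (Cod C k) = e"
    using Idm_Comp[OF H(3)] Comp_Idm[OF H(4)] .
  ultimately have "((k, e), (k, e)) \<in> extension_equiv ?V A2 A1"
    unfolding extension_equiv_def mem_Collect_eq prod.case full_subcategory_sel by blast
  then have "(k, e) \<in> extension_equiv ?V A2 A1 `` {(k, e)}"
    by blast
  moreover have "extension_equiv ?V A2 A1 `` {(k, e)} \<in> Ext ?V A2 A1"
    using \<open>(k, e) \<in> extensions ?V A2 A1\<close> unfolding Ext_def by (rule quotientI)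
  ultimately have "splits ?V e"
    using assms(1) unfolding Ext_eq_zero_def by blast
  then show ?thesis
    unfolding splits_def by (auto simp: Hom_full_subcategory)
qed

text \<open>Inverting the composites gives \<open>f\<close> a left inverse
  \<open>v \<cdot> g\<close> and a right inverse \<open>g \<cdot> u\<close>, which must
  coincide.\<close>

lemma isomorphism_of_both_composites:
  assumes f: "f \<in> Hom C A B" and g: "g \<in> Hom C B A"
    and "is_isomorphism C (g \<cdot> f)" "is_isomorphism C (f \<cdot> g)"
  shows "is_isomorphism C f"
proof -
  obtain v where v: "v \<in> Hom C A A" "v \<cdot> g \<cdot> f = Idm C A"
    using isomorphismE[OF assms(3) Comp_Hom[OF f g]] by blast
  obtain u where u: "u \<in> Hom C B B" "(f \<cdot> g) \<cdot> u = Idm C B"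
    using isomorphismE[OF assms(4) Comp_Hom[OF g f]] by blast
  have gu: "g \<cdot> u \<in> Hom C B A" and vg: "v \<cdot> g \<in> Hom C B A"
    using g u(1) v(1) Comp_Hom by blast+
  have 1: "(v \<cdot> g) \<cdot> f = Idm C A"
    using Comp_assoc[OF f g v(1)] v(2) by simp
  have 2: "f \<cdot> g \<cdot> u = Idm C B"
    using Comp_assoc[OF u(1) g f] u(2) by simp
  have "v \<cdot> g = g \<cdot> u"
    using Comp_assoc[OF gu f vg] 1 2 Comp_Idm[OF vg] Idm_Comp[OF gu] by simp
  then show ?thesis
    using isomorphismI[OF f gu] 1 2 by simp
qed

end

section \<open>Transport of short exact sequences and rigidity of endomorphisms\<close>

context additive_category
begin

lemma short_exact_isomorphic:
  assumes ke: "short_exact C k e" and k: "k \<in> Hom C K H" and e: "e \<in> Hom C H Q"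
    and a: "a \<in> Hom C K' K" "is_isomorphism C a" and z: "z \<in> Hom C Q Q'" "is_isomorphism C z"
  shows "short_exact C (k \<cdot> a) (z \<cdot> e)"
proof -
  obtain a' where a': "a' \<in> Hom C K K'" "a' \<cdot> a = Idm C K'" "a \<cdot> a' = Idm C K"
    using isomorphismE[OF a(2,1)] by blast
  obtain z' where z': "z' \<in> Hom C Q' Q" "z' \<cdot> z = Idm C Q" "z \<cdot> z' = Idm C Q'"
    using isomorphismE[OF z(2,1)] by blast
  have ker: "is_kernel C k e" and coker: "is_cokernel C e k"
    using ke by (auto simp: short_exact_def)
  have ka: "k \<cdot> a \<in> Hom C K' H" and ze: "z \<cdot> e \<in> Hom C H Q'"
    using k a(1) e z(1) Comp_Hom by blast+
  have o: "K' \<in> Obj C" "Q \<in> Obj C" "Q' \<in> Obj C" using a z Hom_Obj by blast+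
  have ek: "e \<cdot> k = Zero C K Q"
    using kernelD(3)[OF ker] k e by (simp add: Hom_def)
  have "e \<cdot> k \<cdot> a = Zero C K' Q"
    using Comp_assoc[OF a(1) k e] ek Zero_Comp[OF a(1) o(2)] by simp
  then have zero: "(z \<cdot> e) \<cdot> k \<cdot> a = Zero C K' Q'"
    using Comp_assoc[OF ka e z(1)] Comp_Zero[OF z(1) o(1)] by simp
  have "is_kernel C (k \<cdot> a) (z \<cdot> e)"
  proof (rule kernelI[OF ka ze zero])
    fix T t
    assume t: "t \<in> Hom C T H" "(z \<cdot> e) \<cdot> t = Zero C T Q'"
    have et: "e \<cdot> t \<in> Hom C T Q" by (rule Comp_Hom[OF t(1) e])
    have "e \<cdot> t = z' \<cdot> z \<cdot> e \<cdot> t"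
      using Comp_assoc[OF et z(1) z'(1)] z'(2) Idm_Comp[OF et] by simp
    also have "\<dots> = Zero C T Q"
      using t(2) Comp_assoc[OF t(1) e z(1)] Comp_Zero[OF z'(1)] Hom_Obj(1)[OF t(1)] by simp
    finally obtain s where s: "s \<in> Hom C T K" "k \<cdot> s = t"
      using kernel_lift[OF ker k e t(1)] by blast
    have as: "a' \<cdot> s \<in> Hom C T K'" by (rule Comp_Hom[OF s(1) a'(1)])
    have "(k \<cdot> a) \<cdot> a' \<cdot> s = t"
      using Comp_assoc[OF as a(1) k] Comp_assoc[OF s(1) a'(1) a(1)] a'(3) Idm_Comp[OF s(1)] s(2)
      by simp
    then show "\<exists>s\<in>Hom C T K'. (k \<cdot> a) \<cdot> s = t" using as by blast
  next
    fix T x y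
    assume xy: "x \<in> Hom C T K'" "y \<in> Hom C T K'" "(k \<cdot> a) \<cdot> x = (k \<cdot> a) \<cdot> y"
    then have "k \<cdot> a \<cdot> x = k \<cdot> a \<cdot> y"
      using Comp_assoc[OF xy(1) a(1) k] Comp_assoc[OF xy(2) a(1) k] by simp
    then have "a \<cdot> x = a \<cdot> y"
      using is_monoD[OF kernel_is_mono[OF ker] k] Comp_Hom[OF _ a(1)] xy by blast
    then show "x = y"
      using Comp_assoc[OF xy(1) a(1) a'(1)] Comp_assoc[OF xy(2) a(1) a'(1)] a'(2)
        Idm_Comp[OF xy(1)] Idm_Comp[OF xy(2)] by simp
  qed
  moreover have "is_cokernel C (z \<cdot> e) (k \<cdot> a)"
  proof (rule cokernelI[OF ze ka zero])
    fix T t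
    assume t: "t \<in> Hom C H T" "t \<cdot> k \<cdot> a = Zero C K' T"
    have tk: "t \<cdot> k \<in> Hom C K T" by (rule Comp_Hom[OF k t(1)])
    have "t \<cdot> k = ((t \<cdot> k) \<cdot> a) \<cdot> a'"
      using Comp_assoc[OF a'(1) a(1) tk] a'(3) Comp_Idm[OF tk] by simp
    also have "\<dots> = Zero C K T"
      using t(2) Comp_assoc[OF a(1) k t(1)] Zero_Comp[OF a'(1)] Hom_Obj(2)[OF t(1)] by simp
    finally obtain s where s: "s \<in> Hom C Q T" "s \<cdot> e = t"
      using cokernel_factor[OF coker e k t(1)] by blast
    have sz: "s \<cdot> z' \<in> Hom C Q' T" by (rule Comp_Hom[OF z'(1) s(1)])
    have "(s \<cdot> z') \<cdot> z \<cdot> e = t"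
      using Comp_assoc[OF e z(1) sz] Comp_assoc[OF z(1) z'(1) s(1)] z'(2) Comp_Idm[OF s(1)] s(2)
      by simp
    then show "\<exists>s\<in>Hom C Q' T. s \<cdot> z \<cdot> e = t" using sz by blast
  next
    fix T x y
    assume xy: "x \<in> Hom C Q' T" "y \<in> Hom C Q' T" "x \<cdot> z \<cdot> e = y \<cdot> z \<cdot> e"
    then have "(x \<cdot> z) \<cdot> e = (y \<cdot> z) \<cdot> e"
      using Comp_assoc[OF e z(1) xy(1)] Comp_assoc[OF e z(1) xy(2)] by simp
    then have eq: "x \<cdot> z = y \<cdot> z"
      using is_epiD[OF cokernel_is_epi[OF coker] e] Comp_Hom[OF z(1)] xy by blast
    have "x = (x \<cdot> z) \<cdot> z'"
      using Comp_assoc[OF z'(1) z(1) xy(1)] z'(3) Comp_Idm[OF xy(1)] by simp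
    also have "\<dots> = y"
      using eq Comp_assoc[OF z'(1) z(1) xy(2)] z'(3) Comp_Idm[OF xy(2)] by simp
    finally show "x = y" .
  qed
  ultimately show ?thesis by (simp add: short_exact_def)
qed

text \<open>The hypothesis on \<open>Ext\<close> concerns \<open>D\<close> itself, while the end
  terms here are only isomorphic to it. The sequence is transported to one with ends
  \<open>D\<close>, and a section \<open>s\<close> found there gives the section
  \<open>s \<cdot> z\<close>.\<close>

lemma extension_splits_isomorphic:
  assumes Ext: "Ext_eq_zero (full_subcategory C V) D D" "D \<in> V"
    and ke: "short_exact C k e" "Cod C k \<in> V"
    and iso: "isomorphic C (Dom C k) D" "isomorphic C (Cod C e) D"
  shows "splits C e"
proof -
  define K H Q where "K = Dom C k" and "H = Cod C k" and "Q = Cod C e"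
  have k: "k \<in> Hom C K H" and e: "e \<in> Hom C H Q"
    using ke(1) kernelD[of k e] by (simp_all add: short_exact_def is_kernel_def Hom_def K_def H_def Q_def)
  obtain a where a: "a \<in> Hom C D K" "is_isomorphism C a"
    using isomorphic_sym[OF iso(1)] by (auto simp: isomorphic_def K_def)
  obtain z where z: "z \<in> Hom C Q D" "is_isomorphism C z"
    using iso(2) by (auto simp: isomorphic_def Q_def)
  obtain z' where z': "z' \<in> Hom C D Q" "z' \<cdot> z = Idm C Q" "z \<cdot> z' = Idm C D"
    using isomorphismE[OF z(2,1)] by blast
  have ka: "k \<cdot> a \<in> Hom C D H" and ze: "z \<cdot> e \<in> Hom C H D"
    using k e a z Comp_Hom by blast+
  have "splits C (z \<cdot> e)"
  proof (rule extension_splits[OF Ext(1) short_exact_isomorphic[OF ke(1) k e a z]])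
    show "Cod C (k \<cdot> a) \<in> V" using ka ke(2) by (simp add: Hom_def H_def)
  qed (use ka ze Ext(2) in \<open>auto simp: Hom_def\<close>)
  then obtain s where s: "s \<in> Hom C D H" "(z \<cdot> e) \<cdot> s = Idm C D"
    using ze by (auto simp: splits_def Hom_def)
  have sz: "s \<cdot> z \<in> Hom C Q H" and es: "e \<cdot> s \<in> Hom C D Q"
    using s(1) z(1) e Comp_Hom by blast+
  have "e \<cdot> s = z' \<cdot> z \<cdot> e \<cdot> s"
    using Comp_assoc[OF es z(1) z'(1)] z'(2) Idm_Comp[OF es] by simp
  also have "\<dots> = z'"
    using Comp_assoc[OF s(1) e z(1)] s(2) Comp_Idm[OF z'(1)] by simp
  finally have "e \<cdot> s \<cdot> z = Idm C Q"
    using Comp_assoc[OF z(1) s(1) e] z'(2) by simp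
  then show ?thesis
    using sz e unfolding splits_def by (auto simp: Hom_def)
qed

text \<open>Since \<open>g\<close> commutes with \<open>l r\<close>, it also induces the identity on the quotient \<open>Q\<close>, so \<open>g\<close> minus
  the identity has square zero.\<close>

lemma isomorphism_of_fixing:
  assumes ir: "short_exact C i r" and i: "i \<in> Hom C A E" and r: "r \<in> Hom C E Q"
    and l: "l \<in> Hom C Q E" "is_mono C l" and lr: "l \<cdot> r = nat_mult C n (Idm C E)"
    and g: "g \<in> Hom C E E" "g \<cdot> i = i" "g \<cdot> l = l"
  shows "is_isomorphism C g"
proof -
  have coker: "is_cokernel C r i" using ir by (simp add: short_exact_def)
  have o: "A \<in> Obj C" "E \<in> Obj C" "Q \<in> Obj C" using i r Hom_Obj by blast+
  have I: "Idm C E \<in> Hom C E E" by (rule Idm_Hom[OF o(2)])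
  have rg: "r \<cdot> g = r"
  proof (rule is_monoD[OF l(2,1) Comp_Hom[OF g(1) r] r])
    show "l \<cdot> r \<cdot> g = l \<cdot> r"
      using Comp_assoc[OF g(1) r l(1)] lr nat_mult_Idm_commute[OF g(1), of n]
        Comp_assoc[OF r l(1) g(1)] g(3) by simp
  qed
  define N where "N = g \<ominus>\<ominus> Idm C E"
  have N: "N \<in> Hom C E E" unfolding N_def by (rule sub_Hom[OF g(1) I])
  have "N \<cdot> i = Zero C A E"
    using sub_Comp[OF i g(1) I] g(2) Idm_Comp[OF i] sub_self[OF i i] by (simp add: N_def)
  \<comment> \<open>\<open>N\<close> factors through \<open>r\<close>, and \<open>r\<close> kills
    \<open>N\<close> because \<open>r \<cdot> g = r\<close>; hence \<open>N\<close> has square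
    zero.\<close>
  then obtain w where w: "w \<in> Hom C Q E" "w \<cdot> r = N"
    using cokernel_factor[OF coker r i N] by blast
  have rN: "r \<cdot> N = Zero C E Q"
    using Comp_sub[OF g(1) I r] rg Comp_Idm[OF r] sub_self[OF r r] by (simp add: N_def)
  have Ng: "N \<cdot> g = N"
    using Comp_assoc[OF g(1) r w(1)] rg w(2) by simp
  have NN: "N \<cdot> N = Zero C E E"
    using Comp_assoc[OF N r w(1)] rN w(2) Comp_Zero[OF w(1) o(2)] by simp
  have g_eq: "g = Add C N (Idm C E)"
    using sub_Add_cancel[OF g(1) I] by (simp add: N_def)
  have gN: "g \<cdot> N = N"
    using Add_Comp[OF N N I] NN Idm_Comp[OF N] Zero_Add[OF N N] by (simp add: g_eq[symmetric])
  have gN_sub: "g \<ominus>\<ominus> N = Idm C E"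
    using sub_eq_iff[OF g(1) N I] g_eq Add_commute[OF N I] by simp
  \<comment> \<open>Since \<open>g\<close> is the identity plus \<open>N\<close>, its inverse is the
    identity minus \<open>N\<close>.\<close>
  show ?thesis
  proof (rule isomorphismI[OF g(1) sub_Hom[OF I N]])
    show "(Idm C E \<ominus>\<ominus> N) \<cdot> g = Idm C E"
      using sub_Comp[OF g(1) I N] Idm_Comp[OF g(1)] Ng gN_sub by simp
    show "g \<cdot> (Idm C E \<ominus>\<ominus> N) = Idm C E"
      using Comp_sub[OF I N g(1)] Comp_Idm[OF g(1)] gN gN_sub by simp
  qed
qed

section \<open>Exact sequences inside a p-divisible group\<close>

lemma comp_from_Hom:
  assumes "is_p_divisible_group p C X i"
  shows "comp_from C X i m k \<in> Hom C (X m) (X (m + k))"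
proof (induction k)
  case 0
  then show ?case using assms Idm_Hom by (simp add: is_p_divisible_group_def)
next
  case (Suc k)
  have "i (m + k) \<in> Hom C (X (m + k)) (X (Suc (m + k)))"
    using assms by (simp add: is_p_divisible_group_def)
  then show ?case using Comp_Hom[OF Suc] by simp
qed

text \<open>These are the cases \<open>m = 1\<close> and \<open>m = n\<close> of the axioms at level
  \<open>n + 1\<close>: \<open>c\<close> is the cokernel of the inclusion of \<open>C(1)\<close>,
  and \<open>r\<close> is the cokernel of \<open>i n\<close>.\<close>

lemma p_divisible_group_sequences:
  assumes "is_p_divisible_group p C X i" "n \<ge> 1"
  obtains l c r where
    "i n \<in> Hom C (X n) (X (Suc n))" "c \<in> Hom C (X (Suc n)) (X n)"
    "i n \<cdot> c = nat_mult C p (Idm C (X (Suc n)))"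
    "l \<in> Hom C (X 1) (X n)" "short_exact C (i n \<cdot> l) c"
    "r \<in> Hom C (X (Suc n)) (X 1)" "short_exact C (i n) r"
    "(i n \<cdot> l) \<cdot> r = nat_mult C (p ^ n) (Idm C (X (Suc n)))"
proof -
  have i: "i n \<in> Hom C (X n) (X (Suc n))"
    using assms by (simp add: is_p_divisible_group_def)
  have div: "\<exists>j\<in>Hom C (X n) (X (n - m)). short_exact C (transition C X i m n) j \<and>
      transition C X i (n - m) n \<cdot> j = nat_mult C (p ^ m) (Idm C (X n))" if "m \<le> n" for m n
    using assms that by (simp add: is_p_divisible_group_def)
  \<comment> \<open>Writing \<open>n\<close> as a successor lets the inclusion of
    \<open>C(1)\<close> into \<open>C(n+1)\<close> end with the factor \<open>i n\<close>; the rest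
    of it is \<open>l\<close>.\<close>
  obtain k where n: "n = Suc k" using assms(2) by (cases n) auto
  define l where "l = comp_from C X i 1 k"
  have l: "l \<in> Hom C (X 1) (X n)"
    using comp_from_Hom[OF assms(1), of 1 k] n by (simp add: l_def)
  have t1: "transition C X i 1 (Suc n) = i n \<cdot> l"
    using n by (simp add: transition_def l_def)
  have tn: "transition C X i n (Suc n) = i n"
    using Comp_Idm[OF i] by (simp add: transition_def)
  show ?thesis
    using div[of 1 "Suc n"] div[of n "Suc n"] t1 tn that[OF i _ _ l] by auto
qed

end

section \<open>Passing from one level to the next\<close>

context special_preabelian_category
begin

text \<open>Extending \<open>f\<close> uses extensions of \<open>X 1\<close> by \<open>Y 1\<close>,
  and extending its inverse uses extensions of \<open>Y 1\<close> by \<open>X 1\<close>; the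
  splitting assumption covers both.\<close>

lemma p_divisible_group_isomorphism_step:
  assumes X: "is_p_divisible_group p C X i" and Y: "is_p_divisible_group p C Y j"
    and n: "n \<ge> 1"
    and f: "f \<in> Hom C (X n) (Y n)" "is_isomorphism C f"
    and splitting: "\<And>k e. \<lbrakk>short_exact C k e; Dom C k \<in> {X 1, Y 1}; Cod C e \<in> {X 1, Y 1};
      killed_by C p (Cod C k)\<rbrakk> \<Longrightarrow> splits C e"
  obtains g where "g \<in> Hom C (X (Suc n)) (Y (Suc n))" "is_isomorphism C g" "g \<cdot> i n = j n \<cdot> f"
proof -
  obtain l c r where i: "i n \<in> Hom C (X n) (X (Suc n))" and c: "c \<in> Hom C (X (Suc n)) (X n)"
    and ic: "i n \<cdot> c = nat_mult C p (Idm C (X (Suc n)))"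
    and l: "l \<in> Hom C (X 1) (X n)" and lc: "short_exact C (i n \<cdot> l) c"
    and r: "r \<in> Hom C (X (Suc n)) (X 1)" and ir: "short_exact C (i n) r"
    and lr: "(i n \<cdot> l) \<cdot> r = nat_mult C (p ^ n) (Idm C (X (Suc n)))"
    by (rule p_divisible_group_sequences[OF X n])
  obtain l' c' r' where j: "j n \<in> Hom C (Y n) (Y (Suc n))" and c': "c' \<in> Hom C (Y (Suc n)) (Y n)"
    and jc: "j n \<cdot> c' = nat_mult C p (Idm C (Y (Suc n)))"
    and l': "l' \<in> Hom C (Y 1) (Y n)" and lc': "short_exact C (j n \<cdot> l') c'"
    and r': "r' \<in> Hom C (Y (Suc n)) (Y 1)" and jr: "short_exact C (j n) r'"
    and lr': "(j n \<cdot> l') \<cdot> r' = nat_mult C (p ^ n) (Idm C (Y (Suc n)))"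
    by (rule p_divisible_group_sequences[OF Y n])
  have il: "i n \<cdot> l \<in> Hom C (X 1) (X (Suc n))" and jl: "j n \<cdot> l' \<in> Hom C (Y 1) (Y (Suc n))"
    using i l j l' Comp_Hom by blast+
  have mono: "is_mono C (i n)" "is_mono C (i n \<cdot> l)" "is_mono C (j n)" "is_mono C (j n \<cdot> l')"
    using ir lc jr lc' kernel_is_mono unfolding short_exact_def by blast+
  obtain f' where f': "f' \<in> Hom C (Y n) (X n)" "f' \<cdot> f = Idm C (X n)" "f \<cdot> f' = Idm C (Y n)"
    using isomorphismE[OF f(2,1)] by blast
  obtain g where g: "g \<in> Hom C (X (Suc n)) (Y (Suc n))" "g \<cdot> i n = j n \<cdot> f"
    by (rule extend_morphism[OF ir i r c ic lc' jl c' j mono(3) jc f(1)]) (use splitting in auto)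
  obtain h where h: "h \<in> Hom C (Y (Suc n)) (X (Suc n))" "h \<cdot> j n = i n \<cdot> f'"
    by (rule extend_morphism[OF jr j r' c' jc lc il c i mono(1) ic f'(1)]) (use splitting in auto)
  have hg: "h \<cdot> g \<in> Hom C (X (Suc n)) (X (Suc n))" and gh: "g \<cdot> h \<in> Hom C (Y (Suc n)) (Y (Suc n))"
    using g(1) h(1) Comp_Hom by blast+
  have hgi: "(h \<cdot> g) \<cdot> i n = i n"
    using Comp_assoc[OF i g(1) h(1)] g(2) Comp_assoc[OF f(1) j h(1)] h(2) Comp_assoc[OF f(1) f'(1) i]
      f'(2) Comp_Idm[OF i] by simp
  have ghj: "(g \<cdot> h) \<cdot> j n = j n"
    using Comp_assoc[OF j h(1) g(1)] h(2) Comp_assoc[OF f'(1) i g(1)] g(2) Comp_assoc[OF f'(1) f(1) j]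
      f'(3) Comp_Idm[OF j] by simp
  \<comment> \<open>The inclusion \<open>i n \<cdot> l\<close> of \<open>C(1)\<close> factors
    through \<open>i n\<close>, so an endomorphism that fixes \<open>i n\<close> fixes it
    too.\<close>
  have "is_isomorphism C (h \<cdot> g)"
    using isomorphism_of_fixing[OF ir i r il mono(2) lr hg hgi] Comp_assoc[OF l i hg] hgi by simp
  moreover have "is_isomorphism C (g \<cdot> h)"
    using isomorphism_of_fixing[OF jr j r' jl mono(4) lr' gh ghj] Comp_assoc[OF l' j gh] ghj by simp
  ultimately have "is_isomorphism C g"
    by (rule isomorphism_of_both_composites[OF g(1) h(1)])
  then show ?thesis using that g by blast
qed

end

section \<open>Compatible isomorphisms at all levels by dependent choice\<close>

theorem theoremA1:
  fixes S :: "('o, 'm) cat" and p :: nat and D :: 'o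
    and X X1 :: "nat \<Rightarrow> 'o" and i i1 :: "nat \<Rightarrow> 'm"
  assumes "prime p"
    and "special_preabelian_category S"
    and "consists_of_group_objects S"
    and "D \<in> Obj (torsion_subcategory S p)"
    and "Ext_eq_zero (torsion_subcategory S p) D D"
    and "is_p_divisible_group p S X i"
    and "is_p_divisible_group p S X1 i1"
    and "isomorphic S (X 1) D"
    and "isomorphic S (X1 1) D"
  shows "\<exists>f. \<forall>n. f n \<in> Hom S (X n) (X1 n) \<and> is_isomorphism S (f n) \<and>
           f (Suc n) \<cdot>\<^bsub>S\<^esub> i n = i1 n \<cdot>\<^bsub>S\<^esub> f n"
proof -
  interpret special_preabelian_category S by (rule assms(2))
  let ?V = "{A. killed_by S p A}"
  let ?P = "\<lambda>n f. f \<in> Hom S (X n) (X1 n) \<and> is_isomorphism S f"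
  let ?Q = "\<lambda>n f g. g \<cdot>\<^bsub>S\<^esub> i n = i1 n \<cdot>\<^bsub>S\<^esub> f"
  note X = assms(6) and X1 = assms(7)
  have splitting: "splits S e" if "short_exact S k e" "Dom S k \<in> {X 1, X1 1}"
    "Cod S e \<in> {X 1, X1 1}" "killed_by S p (Cod S k)" for k e
    using extension_splits_isomorphic[of ?V D k e] that assms(4,5,8,9)
    unfolding torsion_subcategory_def by auto
  have zero: "is_zero_object S (X 0)" "is_zero_object S (X1 0)"
    and i: "i n \<in> Hom S (X n) (X (Suc n))" and i1: "i1 n \<in> Hom S (X1 n) (X1 (Suc n))" for n
    using X X1 by (simp_all add: is_p_divisible_group_def)
  have "\<exists>f. ?P 0 f"
  proof -
    have o: "X 0 \<in> Obj S" "X1 0 \<in> Obj S" using zero by (auto simp: is_zero_object_def)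
    note z = Zero_Hom[OF o] and z' = Zero_Hom[OF o(2,1)]
    have "is_isomorphism S (Zero S (X 0) (X1 0))"
      using isomorphismI[OF z z'] zero_object_unique(1)[OF zero(1) Comp_Hom[OF z z'] Idm_Hom[OF o(1)]]
        zero_object_unique(1)[OF zero(2) Comp_Hom[OF z' z] Idm_Hom[OF o(2)]] by blast
    then show ?thesis using z by blast
  qed
  moreover have "\<exists>g. ?P (Suc n) g \<and> ?Q n f g" if f: "?P n f" for f n
  proof (cases n)
    \<comment> \<open>At the bottom no extension argument is involved: any isomorphism between the
      first levels is compatible, because \<open>X 0\<close> is initial.\<close>
    case 0
    obtain g where g: "g \<in> Hom S (X 1) (X1 1)" "is_isomorphism S g"
      using isomorphic_trans[OF assms(8) isomorphic_sym[OF assms(9)]] by (auto simp: isomorphic_def)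
    have "g \<cdot>\<^bsub>S\<^esub> i 0 \<in> Hom S (X 0) (X1 1)" "i1 0 \<cdot>\<^bsub>S\<^esub> f \<in> Hom S (X 0) (X1 1)"
      using Comp_Hom[OF i[of 0]] Comp_Hom[OF _ i1[of 0]] g(1) f 0 by simp_all
    then have "g \<cdot>\<^bsub>S\<^esub> i 0 = i1 0 \<cdot>\<^bsub>S\<^esub> f"
      using zero_object_unique(2)[OF zero(1)] by blast
    then show ?thesis using g 0 by auto
  next
    case (Suc k)
    \<comment> \<open>From level 1 on, \<open>C(1)\<close> embeds into \<open>C(n)\<close> and the
      extension step applies.\<close>
    then have n: "n \<ge> 1" by simp
    from f have f: "f \<in> Hom S (X n) (X1 n)" "is_isomorphism S f" by auto
    obtain g where "g \<in> Hom S (X (Suc n)) (X1 (Suc n))" "is_isomorphism S g"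
      "g \<cdot>\<^bsub>S\<^esub> i n = i1 n \<cdot>\<^bsub>S\<^esub> f"
      by (rule p_divisible_group_isomorphism_step[OF X X1 n f splitting])
    then show ?thesis by blast
  qed
  ultimately have "\<exists>f. \<forall>n. ?P n (f n) \<and> ?Q n (f n) (f (Suc n))"
    by (rule dependent_nat_choice)
  then show ?thesis by auto
qed

end
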